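(* Suppose that $f$ is $l_f$-smooth and strongly convex, that $A$ is full row rank with $\gamma:=\sqrt{\theta_{\min}(AA^\top)}>0$, and that for the given $\mu>0$ the parameters satisfy $$\rho>\max\left\{\frac{16(c_1^2+c_2^2)}{\mu},\frac{6l_f}{\gamma^2}\right\},\quad \alpha=\frac1\rho,\quad \beta:=\frac{8c_2^2}{\rho},\quad \eta>\frac{4}{\rho\gamma^2},\quad \frac{\epsilon_{k+1}}{\epsilon_k}\le\sqrt{\frac{\rho\gamma^2\eta-4}{\rho\gamma^2\eta+4}}\ \ \forall k,$$ where $c_1:=(\mu+l_f)/\gamma$ and $c_2:=\mu/\gamma$. Let $\{(w^k;u^k;z^k;v^k)\}_{k\in\mathbb{N}}$ be a sequence generated by IALM satisfying the stopping criteria (a) and (b). Then $\lim_{k\to\infty}(w^k;u^k;z^k;v^k)=(w^*;u^*;z^*;w^* )$, where $(w^*;u^*;z^* )$ is a P-stationary triplet of the problem $$\min_{w\in\mathbb{R}^p,\,u\in\mathbb{R}^n} f(w)+\lambda\|u_+\|_0\quad\text{s.t.}\quad Aw+b=u\qquad(\mathrm{O})$$ and $(w^*;u^* )$ is a local minimizer of (O).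
   Context: Setting: $f:\mathbb{R}^p\to\mathbb{R}$ is continuously differentiable, $A\in\mathbb{R}^{n\times p}$, $b\in\mathbb{R}^n$, $\lambda,\rho,\mu>0$. A function is $l$-smooth if its gradient is Lipschitz continuous with constant $l$; $\theta_{\min}$ is the smallest eigenvalue. For $u\in\mathbb{R}^n$, $u_+:=(\max\{0,u_i\})_i$ and $\|u\|_0$ counts nonzero components. $(w;u)$ denotes concatenation; $\|x\|_P^2:=x^\top Px$; ${\rm dist}(u,\Theta):=\inf_{\theta\in\Theta}\|u-\theta\|$. Lyapunov function: $\mathcal{V}_{\rho,\mu}(w,u,z,v):=f(w)+\lambda\|u_+\|_0+\langle z,Aw+b-u\rangle+\frac{\rho}{2}\|Aw+b-u\|^2+\frac{\mu}{2}\|w-v\|^2$. Proximal operator (set-valued): ${\rm Prox}_{\alpha\lambda\|(\cdot)_+\|_0}(z):=\arg\min_{u\in\mathbb{R}^n}\ \lambda\|u_+\|_0+\frac{1}{2\alpha}\|u-z\|^2$. $(w^*;u^*;z^* )$ is a P-stationary triplet of (O) if there is a constant $\alpha>0$ with $\nabla f(w^* )+A^\top z^*=0$, $u^*\in{\rm Prox}_{\alpha\lambda\|(\cdot)_+\|_0}(u^*+\alpha z^* )$, $Aw^*+b-u^*=0$. IALM (inexact augmented Lagrangian method): given a positive sequence $\{\epsilon_k\}_{k\in\mathbb{N}}$, fixed $\mu>0$, $\rho>0$, $\alpha=1/\rho$, start with any $(w^0;u^0;z^0;v^0)\in\mathbb{R}^p\times\mathbb{R}^n\times\mathbb{R}^n\times\mathbb{R}^p$.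 With $h_k(w,u):=f(w)+\frac{\mu}{2}\|w-v^k\|^2+\langle z^k,Aw+b-u\rangle+\frac{\rho}{2}\|Aw+b-u\|^2$, for $k=0,1,\dots$: Primal step: use the inner solver 0/1-BALM to compute $(w^{k+1};u^{k+1})$ as an approximate solution of $\min_{w,u}\mathcal{V}_{\rho,\mu}(w,u,z^k,v^k)$ satisfying the stopping criteria (a) $\mathcal{V}_{\rho,\mu}(w^{k+1},u^{k+1},z^k,v^k)\le\mathcal{V}_{\rho,\mu}(w^k,u^k,z^k,v^k)$, (b) $\max\big\{{\rm dist}\big(u^{k+1},{\rm Prox}_{\alpha\lambda\|(\cdot)_+\|_0}(u^{k+1}-\alpha\nabla_uh_k(w^{k+1},u^{k+1}))\big),\ \|\nabla_wh_k(w^{k+1},u^{k+1})\|\big\}\le\epsilon_k$. Multiplier step: $z^{k+1}=z^k+\rho(Aw^{k+1}+b-u^{k+1})$. Lyapunov step: $v^{k+1}=w^{k+1}$. Inner solver 0/1-BALM: let $t>0$, $Q_{k,j}$ symmetric positive semidefinite, $P_{k,j}:=tI-Q_{k,j}$, $g:\mathbb{R}^p\to\mathbb{R}$ $l_g$-smooth, $\psi_{k,j}(w):=\frac12\|w\|_{P_{k,j}}^2-g(w)$, and $\mathcal{D}_{\psi_{k,j}}(w,w^{k,j}):=\psi_{k,j}(w)-\psi_{k,j}(w^{k,j})-\langle\nabla\psi_{k,j}(w^{k,j}),w-w^{k,j}\rangle$. Starting from $(w^{k,0};u^{k,0})=(w^k;u^k)$, for $j=0,1,\dots$ take $u^{k,j+1}\in{\rm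 Prox}_{\alpha\lambda\|(\cdot)_+\|_0}(u^{k,j}-\alpha\nabla_uh_k(w^{k,j},u^{k,j}))$ and $w^{k,j+1}\in\arg\min_w h_k(w,u^{k,j+1})+\mathcal{D}_{\psi_{k,j}}(w,w^{k,j})$; $(w^{k+1};u^{k+1})$ is an iterate satisfying (a) and (b). *)

theory Defs
  imports "HOL-Analysis.Analysis"
begin

definition grad :: "('a::real_inner \<Rightarrow> real) \<Rightarrow> 'a \<Rightarrow> 'a" where
  "grad F x = (THE D. GDERIV F x :> D)"

lemma grad_eqI:
  assumes "GDERIV F x :> D"
  shows "grad F x = D"
  unfolding grad_def
proof (rule the_equality[where P = "\<lambda>D. GDERIV F x :> D", OF assms])
  fix E assume "GDERIV F x :> E"
  with assms have "(\<lambda>h. h \<bullet> E) = (\<lambda>h. h \<bullet> D)"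
    unfolding gderiv_def using has_derivative_unique by blast
  then have "(E - D) \<bullet> E = (E - D) \<bullet> D" by metis
  then have "(E - D) \<bullet> (E - D) = 0" by (simp add: inner_diff_right)
  then show "E = D" by simp
qed

definition C1 :: "('a::real_inner \<Rightarrow> real) \<Rightarrow> bool" where
  "C1 F \<longleftrightarrow> (\<forall>x. F differentiable (at x)) \<and> continuous_on UNIV (grad F)"

definition smooth_with :: "real \<Rightarrow> ('a::real_inner \<Rightarrow> real) \<Rightarrow> bool" where
  "smooth_with l F \<longleftrightarrow> (\<forall>x. F differentiable (at x)) \<and> l-lipschitz_on UNIV (grad F)"

definition strongly_convex :: "('a::real_inner \<Rightarrow> real) \<Rightarrow> bool" where
  "strongly_convex F \<longleftrightarrow>
     (\<exists>\<sigma>>0. \<forall>x y. \<forall>s\<in>{0..1}.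
        F (s *\<^sub>R x + (1 - s) *\<^sub>R y)
          \<le> s * F x + (1 - s) * F y - \<sigma> / 2 * s * (1 - s) * (norm (x - y))\<^sup>2)"

definition argmin :: "('a \<Rightarrow> real) \<Rightarrow> 'a set" where
  "argmin F = {x. is_arg_min F (\<lambda>_. True) x}"

definition local_minimizer :: "('a::metric_space \<Rightarrow> real) \<Rightarrow> 'a set \<Rightarrow> 'a \<Rightarrow> bool" where
  "local_minimizer F S x \<longleftrightarrow> x \<in> S \<and> (\<exists>r>0. \<forall>y\<in>S \<inter> ball x r. F x \<le> F y)"

definition eigenvalues :: "real^'n^'n \<Rightarrow> real set" where
  "eigenvalues M = {\<theta>. \<exists>x. x \<noteq> 0 \<and> M *v x = \<theta> *\<^sub>R x}"

definition theta_min :: "real^'n^'n \<Rightarrow> real" where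
  "theta_min M = Min (eigenvalues M)"

definition sym_psd :: "real^'n^'n \<Rightarrow> bool" where
  "sym_psd M \<longleftrightarrow> transpose M = M \<and> (\<forall>x. 0 \<le> x \<bullet> (M *v x))"

definition pos_part :: "real^'n \<Rightarrow> real^'n" where
  "pos_part u = (\<chi> i. max 0 (u $ i))"

definition norm0 :: "real^'n \<Rightarrow> nat" where
  "norm0 u = card {i. u $ i \<noteq> 0}"

definition zero_one_loss :: "real \<Rightarrow> real^'n \<Rightarrow> real" where
  "zero_one_loss lam u = lam * real (norm0 (pos_part u))"

definition Prox :: "real \<Rightarrow> real \<Rightarrow> real^'n \<Rightarrow> (real^'n) set" where
  "Prox \<alpha> lam z = argmin (\<lambda>u. zero_one_loss lam u + 1 / (2 * \<alpha>) * (norm (u - z))\<^sup>2)"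

definition objective :: "(real^'p \<Rightarrow> real) \<Rightarrow> real \<Rightarrow> (real^'p) \<times> (real^'n) \<Rightarrow> real" where
  "objective f lam = (\<lambda>(w, u). f w + zero_one_loss lam u)"

definition feasible_set :: "real^'p^'n \<Rightarrow> real^'n \<Rightarrow> ((real^'p) \<times> (real^'n)) set" where
  "feasible_set A b = {(w, u). A *v w + b = u}"

definition P_stationary ::
  "(real^'p \<Rightarrow> real) \<Rightarrow> real \<Rightarrow> real^'p^'n \<Rightarrow> real^'n \<Rightarrow> real^'p \<Rightarrow> real^'n \<Rightarrow> real^'n \<Rightarrow> bool" where
  "P_stationary f lam A b w u z \<longleftrightarrow>
     (\<exists>\<alpha>>0. grad f w + transpose A *v z = 0
           \<and> u \<in> Prox \<alpha> lam (u + \<alpha> *\<^sub>R z)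
           \<and> A *v w + b - u = 0)"

definition lyapunov ::
  "(real^'p \<Rightarrow> real) \<Rightarrow> real \<Rightarrow> real^'p^'n \<Rightarrow> real^'n \<Rightarrow> real \<Rightarrow> real
     \<Rightarrow> real^'p \<Rightarrow> real^'n \<Rightarrow> real^'n \<Rightarrow> real^'p \<Rightarrow> real" where
  "lyapunov f lam A b \<rho> \<mu> w u z v =
     f w + zero_one_loss lam u + z \<bullet> (A *v w + b - u)
       + \<rho> / 2 * (norm (A *v w + b - u))\<^sup>2 + \<mu> / 2 * (norm (w - v))\<^sup>2"

text \<open>The smooth part of the subproblem with multiplier \<open>zk\<close> and proximal centre \<open>vk\<close>.\<close>

definition h_sub ::
  "(real^'p \<Rightarrow> real) \<Rightarrow> real^'p^'n \<Rightarrow> real^'n \<Rightarrow> real \<Rightarrow> real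
     \<Rightarrow> real^'n \<Rightarrow> real^'p \<Rightarrow> real^'p \<Rightarrow> real^'n \<Rightarrow> real" where
  "h_sub f A b \<rho> \<mu> zk vk w u =
     f w + \<mu> / 2 * (norm (w - vk))\<^sup>2 + zk \<bullet> (A *v w + b - u)
       + \<rho> / 2 * (norm (A *v w + b - u))\<^sup>2"

definition psi_kernel :: "real \<Rightarrow> real^'p^'p \<Rightarrow> (real^'p \<Rightarrow> real) \<Rightarrow> real^'p \<Rightarrow> real" where
  "psi_kernel t Q g w = 1 / 2 * (w \<bullet> ((mat t - Q) *v w)) - g w"

definition bregman :: "('a::real_inner \<Rightarrow> real) \<Rightarrow> 'a \<Rightarrow> 'a \<Rightarrow> real" where
  "bregman \<psi> x y = \<psi> x - \<psi> y - grad \<psi> y \<bullet> (x - y)"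

text \<open>One inner step from \<open>(w, u)\<close> to \<open>(w', u')\<close>; \<open>h\<close> is the current smooth part
  and \<open>\<psi>\<close> the current Bregman kernel.\<close>

definition balm_step ::
  "real \<Rightarrow> real \<Rightarrow> (real^'p \<Rightarrow> real^'n \<Rightarrow> real) \<Rightarrow> (real^'p \<Rightarrow> real)
     \<Rightarrow> real^'p \<Rightarrow> real^'n \<Rightarrow> real^'p \<Rightarrow> real^'n \<Rightarrow> bool" where
  "balm_step \<alpha> lam h \<psi> w u w' u' \<longleftrightarrow>
     u' \<in> Prox \<alpha> lam (u - \<alpha> *\<^sub>R grad (\<lambda>y. h w y) u) \<and>
     w' \<in> argmin (\<lambda>x. h x u' + bregman \<psi> x w)"

text \<open>\<open>(w', u')\<close> is the iterate number \<open>J\<close>, for some \<open>J\<close>, of an inner run started at \<open>(w, u)\<close>.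
  Nothing is required of the run beyond \<open>J\<close>.\<close>

definition balm_output ::
  "real \<Rightarrow> real \<Rightarrow> (real^'p \<Rightarrow> real^'n \<Rightarrow> real) \<Rightarrow> (nat \<Rightarrow> real^'p \<Rightarrow> real)
     \<Rightarrow> real^'p \<Rightarrow> real^'n \<Rightarrow> real^'p \<Rightarrow> real^'n \<Rightarrow> bool" where
  "balm_output \<alpha> lam h \<psi> w u w' u' \<longleftrightarrow>
     (\<exists>J W U. W 0 = w \<and> U 0 = u
        \<and> (\<forall>j<J. balm_step \<alpha> lam h (\<psi> j) (W j) (U j) (W (Suc j)) (U (Suc j)))
        \<and> w' = W J \<and> u' = U J)"

definition stop_a ::
  "(real^'p \<Rightarrow> real) \<Rightarrow> real \<Rightarrow> real^'p^'n \<Rightarrow> real^'n \<Rightarrow> real \<Rightarrow> real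
     \<Rightarrow> real^'p \<Rightarrow> real^'n \<Rightarrow> real^'n \<Rightarrow> real^'p \<Rightarrow> real^'p \<Rightarrow> real^'n \<Rightarrow> bool" where
  "stop_a f lam A b \<rho> \<mu> w u z v w' u' \<longleftrightarrow>
     lyapunov f lam A b \<rho> \<mu> w' u' z v \<le> lyapunov f lam A b \<rho> \<mu> w u z v"

text \<open>\<^const>\<open>infdist\<close> is \<open>0\<close> on the empty set; this is harmless below, since for
  \<open>\<alpha>, lam > 0\<close> the set \<open>Prox \<alpha> lam z\<close> is never empty.\<close>

definition stop_b ::
  "real \<Rightarrow> real \<Rightarrow> (real^'p \<Rightarrow> real^'n \<Rightarrow> real) \<Rightarrow> real \<Rightarrow> real^'p \<Rightarrow> real^'n \<Rightarrow> bool" where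
  "stop_b \<alpha> lam h e w' u' \<longleftrightarrow>
     max (infdist u' (Prox \<alpha> lam (u' - \<alpha> *\<^sub>R grad (\<lambda>y. h w' y) u')))
         (norm (grad (\<lambda>x. h x u') w')) \<le> e"

definition IALM ::
  "(real^'p \<Rightarrow> real) \<Rightarrow> real \<Rightarrow> real^'p^'n \<Rightarrow> real^'n \<Rightarrow> real \<Rightarrow> real \<Rightarrow> real
     \<Rightarrow> real \<Rightarrow> (nat \<Rightarrow> nat \<Rightarrow> real^'p^'p) \<Rightarrow> (real^'p \<Rightarrow> real) \<Rightarrow> (nat \<Rightarrow> real)
     \<Rightarrow> (nat \<Rightarrow> real^'p) \<Rightarrow> (nat \<Rightarrow> real^'n) \<Rightarrow> (nat \<Rightarrow> real^'n) \<Rightarrow> (nat \<Rightarrow> real^'p) \<Rightarrow> bool" where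
  "IALM f lam A b \<rho> \<mu> \<alpha> t Q g \<epsilon> w u z v \<longleftrightarrow>
     (\<forall>k. let h = h_sub f A b \<rho> \<mu> (z k) (v k) in
        balm_output \<alpha> lam h (\<lambda>j. psi_kernel t (Q k j) g) (w k) (u k) (w (Suc k)) (u (Suc k))
      \<and> stop_a f lam A b \<rho> \<mu> (w k) (u k) (z k) (v k) (w (Suc k)) (u (Suc k))
      \<and> stop_b \<alpha> lam h (\<epsilon> k) (w (Suc k)) (u (Suc k))
      \<and> z (Suc k) = z k + \<rho> *\<^sub>R (A *v w (Suc k) + b - u (Suc k))
      \<and> v (Suc k) = w (Suc k))"

end

theory Submission
  imports Defs
begin

text \<open>
  The multiplier update makes the exit criteria of the subproblem into approximate optimality conditions
  for the original problem: with the new multiplier, criterion (b) says that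
  \<open>grad f w + \<mu> *\<^sub>R (w - v) + transpose A *v z\<close> is small and that \<open>u\<close> is almost a proximal fixed
  point for \<open>u + \<alpha> *\<^sub>R z\<close>. So every limit point along which the steps of \<open>w\<close> and \<open>z\<close> vanish is
  P-stationary. Three ideas turn this into convergence.

  \<^item> A Lyapunov energy: the augmented Lagrangian plus \<open>\<beta> / 2\<close> times the last squared step of
    \<open>w\<close>. Full row rank gives \<open>\<gamma> * norm q \<le> norm (transpose A *v q)\<close>, so differences of the
    optimality conditions bound the multiplier steps by the last two steps of \<open>w\<close> and the tolerances.
    For large \<open>\<rho>\<close> the increase due to the multiplier update is then less than the
    decrease provided by the proximal term and criterion (a), up to a summable error, because the tolerances
    decay geometrically (lemma \<open>energy_decrease\<close>).

  \<^item> The energy is bounded below (lemma \<open>energy_lower_bound\<close>). Its only dangerous term is quadratic in the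
    multiplier; the optimality condition trades it for the squared gradient of \<open>f\<close>, and smoothness
    bounds that by the gap between \<open>f\<close> and a lower bound. For large \<open>\<rho>\<close> this costs only half of the
    gap. Hence the steps are square summable, and \<open>w\<close> stays bounded since a strongly convex \<open>f\<close> has
    bounded sublevel sets.

  \<^item> There are only finitely many stationary \<open>w\<close> (lemma \<open>finite_stationary_points\<close>): the
    multiplier lives on the zero set of \<open>u\<close>, and for each zero set strong convexity leaves at most one
    point. A bounded sequence with vanishing steps and finitely many limit points converges
    (lemma \<open>converges_if_finitely_many_limit_points\<close>); \<open>z\<close> and \<open>u\<close> follow \<open>w\<close> through
    the optimality condition and the constraint.

  A stationary point is a local minimizer because near it either a zero coordinate of \<open>u\<close> turns
  positive, which costs a full \<open>lam\<close>, or the multiplier certifies that the convex function \<open>f\<close> cannot decrease.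
\<close>

section \<open>Gradients, smoothness and strong convexity\<close>

lemma GDERIV_grad:
  fixes F :: "'a::euclidean_space \<Rightarrow> real"
  assumes "F differentiable (at x)"
  shows "GDERIV F x :> grad F x"
proof -
  obtain F' where F': "(F has_derivative F') (at x)"
    using assms by (auto simp: differentiable_def)
  define D where "D = (\<Sum>e\<in>Basis. F' e *\<^sub>R e)"
  have lin: "linear F'" using F' by (rule has_derivative_linear)
  have "F' h = h \<bullet> D" for h
  proof -
    have "F' h = F' (\<Sum>e\<in>Basis. (h \<bullet> e) *\<^sub>R e)" by (simp add: euclidean_representation)
    also have "\<dots> = (\<Sum>e\<in>Basis. (h \<bullet> e) * F' e)"
      by (simp add: linear_sum[OF lin] linear_scale[OF lin])
    also have "\<dots> = h \<bullet> D" by (simp add: D_def inner_sum_right mult.commute)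
    finally show ?thesis .
  qed
  then have "F' = (\<lambda>h. h \<bullet> D)" by auto
  then have "GDERIV F x :> D" using F' by (simp add: gderiv_def)
  then show ?thesis using grad_eqI by metis
qed

lemma DERIV_along_line:
  assumes "\<And>x. GDERIV F x :> grad F x"
  shows "((\<lambda>s. F (x + s *\<^sub>R d)) has_real_derivative grad F (x + s *\<^sub>R d) \<bullet> d) (at s)"
proof -
  have F: "(F has_derivative (\<lambda>h. h \<bullet> grad F (x + s *\<^sub>R d))) (at (x + s *\<^sub>R d))"
    using assms by (simp add: gderiv_def)
  have line: "((\<lambda>s. x + s *\<^sub>R d) has_derivative (\<lambda>h. h *\<^sub>R d)) (at s)"
    by (auto intro!: derivative_eq_intros)
  have "((\<lambda>s. F (x + s *\<^sub>R d)) has_derivative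
      (\<lambda>h. (h *\<^sub>R d) \<bullet> grad F (x + s *\<^sub>R d))) (at s)"
    by (rule has_derivative_compose[OF line F])
  moreover have "(\<lambda>h. (h *\<^sub>R d) \<bullet> grad F (x + s *\<^sub>R d)) = (*) (grad F (x + s *\<^sub>R d) \<bullet> d)"
    by (auto simp: inner_commute)
  ultimately show ?thesis by (simp add: has_field_derivative_def)
qed

text \<open>
  Along the line through \<open>x\<close> in direction \<open>d\<close> the gap between \<open>F\<close> and its quadratic upper
  model has nonpositive derivative on \<open>[0, 1]\<close>, because the Lipschitz bound controls the change of
  the directional derivative.
\<close>

lemma descent_lemma:
  assumes gr: "\<And>x. GDERIV F x :> grad F x" and lip: "L-lipschitz_on UNIV (grad F)"
  shows "F (x + d) \<le> F x + grad F x \<bullet> d + L / 2 * (norm d)\<^sup>2"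
proof -
  define \<phi> where "\<phi> s = F (x + s *\<^sub>R d) - s * (grad F x \<bullet> d) - L / 2 * s\<^sup>2 * (norm d)\<^sup>2" for s
  have "\<phi> 1 \<le> \<phi> 0"
  proof (rule DERIV_nonpos_imp_nonincreasing[where f = \<phi>])
    fix s :: real assume s: "0 \<le> s" "s \<le> 1"
    have der: "(\<phi> has_real_derivative
        grad F (x + s *\<^sub>R d) \<bullet> d - grad F x \<bullet> d - L * s * (norm d)\<^sup>2) (at s)"
      unfolding \<phi>_def
      by (auto intro!: derivative_eq_intros DERIV_along_line[OF gr])
    have "grad F (x + s *\<^sub>R d) \<bullet> d - grad F x \<bullet> d = (grad F (x + s *\<^sub>R d) - grad F x) \<bullet> d"
      by (simp add: inner_diff_left)
    also have "\<dots> \<le> norm (grad F (x + s *\<^sub>R d) - grad F x) * norm d"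
      by (rule norm_cauchy_schwarz)
    also have "\<dots> \<le> L * norm (s *\<^sub>R d) * norm d"
      using lipschitz_onD[OF lip, of "x + s *\<^sub>R d" x]
      by (intro mult_right_mono) (auto simp: dist_norm)
    also have "\<dots> = L * s * (norm d)\<^sup>2" using s by (simp add: power2_eq_square)
    finally show "\<exists>D. (\<phi> has_real_derivative D) (at s) \<and> D \<le> 0"
      using der by auto
  qed simp
  then show ?thesis by (simp add: \<phi>_def)
qed

text \<open>
  A gradient step of length \<open>1 / L\<close> lowers \<open>F\<close> by at least \<open>(norm (grad F x))\<^sup>2 / (2 * L)\<close>, and
  it cannot get below \<open>m\<close>. Multipliers are controlled by gradients of \<open>f\<close>, so this inequality is
  what lets \<open>f\<close> itself absorb the multiplier term of the augmented Lagrangian.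
\<close>

lemma gradient_norm_le_gap:
  assumes gr: "\<And>x. GDERIV F x :> grad F x" and lip: "L-lipschitz_on UNIV (grad F)"
    and "L > 0" and low: "\<And>x. m \<le> F x"
  shows "(norm (grad F x))\<^sup>2 \<le> 2 * L * (F x - m)"
proof -
  have "m \<le> F (x + (- (1 / L)) *\<^sub>R grad F x)" by (rule low)
  also have "\<dots> \<le> F x + grad F x \<bullet> ((- (1 / L)) *\<^sub>R grad F x)
      + L / 2 * (norm ((- (1 / L)) *\<^sub>R grad F x))\<^sup>2"
    by (rule descent_lemma[OF gr lip])
  also have "\<dots> = F x - (norm (grad F x))\<^sup>2 / (2 * L)"
    using \<open>L > 0\<close> by (simp add: power2_norm_eq_inner[symmetric] power_divide field_simps power2_eq_square)
  finally show ?thesis using \<open>L > 0\<close> by (simp add: field_simps)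
qed

text \<open>
  Strong convexity bounds the difference quotients of \<open>F\<close> at \<open>x\<close> towards \<open>y\<close>; letting the step
  tend to \<open>0\<close> from the right turns them into the directional derivative.
\<close>

lemma strongly_convex_first_order:
  assumes gr: "\<And>x. GDERIV F x :> grad F x" and "strongly_convex F"
  obtains \<sigma> where "\<sigma> > 0"
    and "\<And>x y. F x + grad F x \<bullet> (y - x) + \<sigma> / 2 * (norm (y - x))\<^sup>2 \<le> F y"
proof -
  obtain \<sigma> where \<sigma>: "\<sigma> > 0" and sc: "\<And>x y s. 0 \<le> s \<Longrightarrow> s \<le> 1 \<Longrightarrow>
      F (s *\<^sub>R x + (1 - s) *\<^sub>R y)
          \<le> s * F x + (1 - s) * F y - \<sigma> / 2 * s * (1 - s) * (norm (x - y))\<^sup>2"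
    using assms(2) by (auto simp: strongly_convex_def)
  have "F x + grad F x \<bullet> (y - x) + \<sigma> / 2 * (norm (y - x))\<^sup>2 \<le> F y" for x y
  proof -
    let ?d = "y - x" and ?N = "(norm (y - x))\<^sup>2"
    have "((\<lambda>s. F (x + s *\<^sub>R ?d)) has_real_derivative grad F (x + 0 *\<^sub>R ?d) \<bullet> ?d) (at 0)"
      by (rule DERIV_along_line[OF gr])
    then have "((\<lambda>s. (F (x + s *\<^sub>R ?d) - F x) / s) \<longlongrightarrow> grad F x \<bullet> ?d) (at 0)"
      by (simp add: DERIV_def)
    then have lim: "((\<lambda>s. (F (x + s *\<^sub>R ?d) - F x) / s) \<longlongrightarrow> grad F x \<bullet> ?d) (at_right 0)"
      by (rule tendsto_mono[rotated]) (simp add: at_le)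
    have rhs: "((\<lambda>s. F y - F x - \<sigma> / 2 * (1 - s) * ?N) \<longlongrightarrow> F y - F x - \<sigma> / 2 * (1 - 0) * ?N)
        (at_right 0)"
      by (intro tendsto_intros)
    have "\<forall>\<^sub>F s in at_right 0. (F (x + s *\<^sub>R ?d) - F x) / s
        \<le> F y - F x - \<sigma> / 2 * (1 - s) * ?N"
      unfolding eventually_at_right_field
    proof (intro exI[of _ 1] conjI allI impI)
      fix s :: real assume s: "0 < s" "s < 1"
      have "x + s *\<^sub>R ?d = s *\<^sub>R y + (1 - s) *\<^sub>R x" by (simp add: algebra_simps)
      then have "F (x + s *\<^sub>R ?d) \<le> s * F y + (1 - s) * F x - \<sigma> / 2 * s * (1 - s) * ?N"
        using sc[of s y x] s by simp
      then have "F (x + s *\<^sub>R ?d) - F x \<le> (F y - F x - \<sigma> / 2 * (1 - s) * ?N) * s"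
        by (simp add: algebra_simps)
      then show "(F (x + s *\<^sub>R ?d) - F x) / s \<le> F y - F x - \<sigma> / 2 * (1 - s) * ?N"
        using s by (simp add: pos_divide_le_eq)
    qed simp
    from tendsto_le[OF _ rhs lim this] show ?thesis by simp
  qed
  with \<sigma> that show thesis by blast
qed

text \<open>
  Gives both facts that are needed about sublevel sets: \<open>F\<close> is bounded below, and an upper bound
  on \<open>F\<close> is an upper bound on the norm. Half of the quadratic term is spent on the linear term.
\<close>

lemma quadratic_growth:
  assumes sc: "\<And>x y. F x + grad F x \<bullet> (y - x) + \<sigma> / 2 * (norm (y - x))\<^sup>2 \<le> F y"
    and "\<sigma> > 0"
  shows "F 0 - (norm (grad F 0))\<^sup>2 / \<sigma> + \<sigma> / 4 * (norm y)\<^sup>2 \<le> F y"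
proof -
  define a n where "a = norm (grad F 0)" and "n = norm y"
  have "- (a * n) \<le> grad F 0 \<bullet> y"
    using Cauchy_Schwarz_ineq2[of "grad F 0" y] by (auto simp: a_def n_def)
  moreover have "F 0 + grad F 0 \<bullet> y + \<sigma> / 2 * n\<^sup>2 \<le> F y" using sc[of 0 y] by (simp add: n_def)
  moreover have "a * n \<le> a\<^sup>2 / \<sigma> + \<sigma> / 4 * n\<^sup>2"
  proof -
    have "0 \<le> (a - \<sigma> / 2 * n)\<^sup>2 / \<sigma>" using \<open>\<sigma> > 0\<close> by simp
    also have "\<dots> = a\<^sup>2 / \<sigma> + \<sigma> / 4 * n\<^sup>2 - a * n"
      using \<open>\<sigma> > 0\<close> by (simp add: power2_eq_square field_simps)
    finally show ?thesis by simp
  qed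
  ultimately show ?thesis unfolding a_def[symmetric] n_def[symmetric] by simp
qed

section \<open>The smallest eigenvalue of a Gram matrix\<close>

lemma inner_transpose:
  fixes A :: "real^'p^'n"
  shows "(transpose A *v q) \<bullet> h = q \<bullet> (A *v h)"
  by (simp add: dot_lmul_matrix)

lemma zero_if_quadratic_nonneg:
  fixes c e :: real
  assumes "\<And>s. 0 \<le> s * c + s\<^sup>2 * e"
  shows "c = 0"
proof (rule ccontr)
  assume "c \<noteq> 0"
  \<comment> \<open>small enough for the linear term to dominate the quadratic one\<close>
  define s where "s = - c / (\<bar>e\<bar> + 1)"
  have "s * c + s\<^sup>2 * e = c\<^sup>2 / (\<bar>e\<bar> + 1)\<^sup>2 * (e - (\<bar>e\<bar> + 1))"
    by (simp add: s_def power2_eq_square divide_simps) (simp add: algebra_simps)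
  also have "\<dots> < 0" using \<open>c \<noteq> 0\<close> by (intro mult_pos_neg) auto
  finally show False using assms[of s] by simp
qed

text \<open>
  Eigenvectors for distinct eigenvalues are orthogonal, hence independent. Finiteness is what makes
  the \<open>Min\<close> in \<^const>\<open>theta_min\<close> an actual lower bound.
\<close>

lemma finite_eigenvalues_symmetric:
  fixes M :: "real^'n^'n"
  assumes sym: "\<And>x y. (M *v x) \<bullet> y = x \<bullet> (M *v y)"
  shows "finite (eigenvalues M)"
proof -
  have "\<forall>\<theta>\<in>eigenvalues M. \<exists>x. x \<noteq> 0 \<and> M *v x = \<theta> *\<^sub>R x" by (simp add: eigenvalues_def)
  then obtain X where X: "\<And>\<theta>. \<theta> \<in> eigenvalues M \<Longrightarrow> X \<theta> \<noteq> 0"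
      "\<And>\<theta>. \<theta> \<in> eigenvalues M \<Longrightarrow> M *v X \<theta> = \<theta> *\<^sub>R X \<theta>"
    by metis
  have orth: "X a \<bullet> X c = 0" if "a \<in> eigenvalues M" "c \<in> eigenvalues M" "a \<noteq> c" for a c
    using sym[of "X a" "X c"] X(2)[OF that(1)] X(2)[OF that(2)] that(3) by simp
  have inj: "inj_on X (eigenvalues M)"
    using orth X(1) by (metis inj_onI inner_eq_zero_iff)
  have "pairwise orthogonal (X ` eigenvalues M)"
    using orth by (auto simp: pairwise_def orthogonal_def)
  moreover have "0 \<notin> X ` eigenvalues M" using X(1) by force
  ultimately have "independent (X ` eigenvalues M)"
    by (rule pairwise_orthogonal_independent)
  then have "finite (X ` eigenvalues M)" by (rule independent_imp_finite)
  with inj show ?thesis using finite_imageD by blast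
qed

text \<open>
  The Rayleigh quotient attains its minimum \<open>m\<close> on the unit sphere. The form
  \<open>x \<bullet> (M *v x) - m * (x \<bullet> x)\<close> is then nonnegative and vanishes at the minimizer, so its first variation
  vanishes there too, which says that the minimizer is an eigenvector with eigenvalue \<open>m\<close>.
\<close>

lemma theta_min_rayleigh:
  fixes M :: "real^'n^'n"
  assumes sym: "\<And>x y. (M *v x) \<bullet> y = x \<bullet> (M *v y)"
  shows "theta_min M * (norm q)\<^sup>2 \<le> q \<bullet> (M *v q)"
proof -
  let ?R = "\<lambda>x::real^'n. x \<bullet> (M *v x)"
  have "continuous_on (sphere 0 1) ?R" by (intro continuous_intros matrix_vector_mult_linear_continuous_on)
  moreover have "sphere (0::real^'n) 1 \<noteq> {}" by simp
  ultimately obtain p where p: "norm p = 1" "\<And>x. norm x = 1 \<Longrightarrow> ?R p \<le> ?R x"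
    using continuous_attains_inf[of "sphere (0::real^'n) 1" ?R] by auto
  define m where "m = ?R p"
  have ge: "m * (norm x)\<^sup>2 \<le> ?R x" for x
  proof (cases "x = 0")
    case False
    have "m \<le> ?R ((1 / norm x) *\<^sub>R x)" unfolding m_def using False by (intro p(2)) simp
    also have "\<dots> = ?R x / (norm x)\<^sup>2"
      by (simp add: matrix_vector_mult_scaleR power2_eq_square)
    finally show ?thesis using False by (simp add: pos_le_divide_eq)
  qed simp
  \<comment> \<open>half the gradient of the form at \<open>p\<close>, also used as the direction of variation\<close>
  define r where "r = M *v p - m *\<^sub>R p"
  have "2 * (r \<bullet> r) = 0"
  proof (rule zero_if_quadratic_nonneg)
    fix s
    have "0 \<le> ?R (p + s *\<^sub>R r) - m * (norm (p + s *\<^sub>R r))\<^sup>2" using ge by simp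
    also have "\<dots> = (?R p - m * (p \<bullet> p)) + s * (2 * (r \<bullet> (M *v p) - m * (r \<bullet> p)))
        + s\<^sup>2 * (?R r - m * (r \<bullet> r))"
    proof -
      have "p \<bullet> (M *v r) = r \<bullet> (M *v p)" by (metis sym inner_commute)
      then have "?R (p + s *\<^sub>R r) = ?R p + 2 * s * (r \<bullet> (M *v p)) + s\<^sup>2 * ?R r"
        by (simp add: matrix_vector_right_distrib matrix_vector_mult_scaleR inner_add_left
            inner_add_right power2_eq_square algebra_simps)
      moreover have "(norm (p + s *\<^sub>R r))\<^sup>2 = p \<bullet> p + 2 * s * (r \<bullet> p) + s\<^sup>2 * (r \<bullet> r)"
        unfolding power2_norm_eq_inner
        by (simp add: inner_add_left inner_add_right inner_commute[of p r]
            power2_eq_square algebra_simps)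
      ultimately show ?thesis by (simp only:) argo
    qed
    also have "?R p - m * (p \<bullet> p) = 0" using p(1) by (simp add: m_def dot_square_norm)
    also have "r \<bullet> (M *v p) - m * (r \<bullet> p) = r \<bullet> r"
      by (simp add: r_def inner_diff_right algebra_simps)
    finally show "0 \<le> s * (2 * (r \<bullet> r)) + s\<^sup>2 * (?R r - m * (r \<bullet> r))" by simp
  qed
  then have "M *v p = m *\<^sub>R p" by (simp add: r_def)
  moreover have "p \<noteq> 0" using p(1) by auto
  ultimately have "m \<in> eigenvalues M" by (auto simp: eigenvalues_def)
  then have "theta_min M \<le> m"
    unfolding theta_min_def by (intro Min_le finite_eigenvalues_symmetric sym)
  then have "theta_min M * (norm q)\<^sup>2 \<le> m * (norm q)\<^sup>2" by (rule mult_right_mono) simp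
  with ge[of q] show ?thesis by simp
qed

lemma transpose_bounded_below:
  fixes A :: "real^'p^'n"
  assumes "\<gamma> = sqrt (theta_min (A ** transpose A))" and "\<gamma> > 0"
  shows "\<gamma> * norm q \<le> norm (transpose A *v q)"
proof -
  let ?M = "A ** transpose A"
  have M: "x \<bullet> (?M *v y) = (transpose A *v x) \<bullet> (transpose A *v y)" for x y
    unfolding inner_transpose by (simp only: matrix_vector_mul_assoc)
  have "theta_min ?M * (norm q)\<^sup>2 \<le> q \<bullet> (?M *v q)"
    by (rule theta_min_rayleigh) (metis M inner_commute)
  moreover have "\<gamma>\<^sup>2 = theta_min ?M" using assms by (metis less_eq_real_def real_sqrt_gt_0_iff real_sqrt_pow2)
  ultimately have "(\<gamma> * norm q)\<^sup>2 \<le> (norm (transpose A *v q))\<^sup>2"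
    by (simp only: M power_mult_distrib power2_norm_eq_inner)
  then show ?thesis by (rule power2_le_imp_le) simp
qed

section \<open>The proximal operator of the zero-one loss\<close>

text \<open>
  The proximal objective is separable; this is its summand for one coordinate, with \<open>s\<close> the
  coordinate of the proximal centre and \<open>t\<close> the coordinate of the argument.
\<close>

definition coord_cost :: "real \<Rightarrow> real \<Rightarrow> real \<Rightarrow> real \<Rightarrow> real" where
  "coord_cost lam \<alpha> s t = (if 0 < t then lam else 0) + 1 / (2 * \<alpha>) * (t - s)\<^sup>2"

lemma norm0_pos_part: "norm0 (pos_part u) = card {i. 0 < u $ i}"
  by (auto simp: norm0_def pos_part_def max_def intro!: arg_cong[of _ _ card])

lemma prox_objective_sum:
  fixes u z :: "real^'n"
  shows "zero_one_loss lam u + 1 / (2 * \<alpha>) * (norm (u - z))\<^sup>2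
    = (\<Sum>i\<in>UNIV. coord_cost lam \<alpha> (z $ i) (u $ i))"
proof -
  have "zero_one_loss lam u = (\<Sum>i\<in>UNIV. if 0 < u $ i then lam else 0)"
    by (simp add: zero_one_loss_def norm0_pos_part sum.If_cases)
  moreover have "(norm (u - z))\<^sup>2 = (\<Sum>i\<in>UNIV. (u $ i - z $ i)\<^sup>2)"
    unfolding power2_norm_eq_inner by (simp add: inner_vec_def power2_eq_square)
  ultimately show ?thesis by (simp add: coord_cost_def sum.distrib sum_distrib_left)
qed

text \<open>
  A minimizer of a separable sum minimizes every summand: vary one coordinate and keep the others.
  All further facts about \<^const>\<open>Prox\<close> are thereby one-dimensional.
\<close>

lemma Prox_iff_coordinatewise:
  "u \<in> Prox \<alpha> lam z \<longleftrightarrow> (\<forall>i t. coord_cost lam \<alpha> (z $ i) (u $ i) \<le> coord_cost lam \<alpha> (z $ i) t)"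
proof -
  let ?c = "\<lambda>i. coord_cost lam \<alpha> (z $ i)"
  have Prox: "u \<in> Prox \<alpha> lam z \<longleftrightarrow> (\<forall>y. (\<Sum>i\<in>UNIV. ?c i (u $ i)) \<le> (\<Sum>i\<in>UNIV. ?c i (y $ i)))"
    by (auto simp: Prox_def argmin_def is_arg_min_def prox_objective_sum not_less simp del: times_divide_eq_left times_divide_eq_right mult_1)
  show ?thesis
  proof
    assume u: "u \<in> Prox \<alpha> lam z"
    show "\<forall>i t. ?c i (u $ i) \<le> ?c i t"
    proof (intro allI)
      fix i t
      define y where "y = (\<chi> j. if j = i then t else u $ j)"
      have "(\<Sum>j\<in>UNIV. ?c j (u $ j)) \<le> (\<Sum>j\<in>UNIV. ?c j (y $ j))" using u Prox by blast
      then have "?c i (u $ i) + (\<Sum>j\<in>UNIV - {i}. ?c j (u $ j))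
          \<le> ?c i (y $ i) + (\<Sum>j\<in>UNIV - {i}. ?c j (y $ j))"
        by (simp add: sum.remove[of UNIV i])
      moreover have "(\<Sum>j\<in>UNIV - {i}. ?c j (y $ j)) = (\<Sum>j\<in>UNIV - {i}. ?c j (u $ j))"
        by (intro sum.cong) (auto simp: y_def)
      ultimately show "?c i (u $ i) \<le> ?c i t" by (simp add: y_def)
    qed
  next
    assume "\<forall>i t. ?c i (u $ i) \<le> ?c i t"
    then show "u \<in> Prox \<alpha> lam z" unfolding Prox by (auto intro: sum_mono)
  qed
qed

text \<open>
  In one dimension a minimizer is explicit (hard thresholding): keep \<open>s\<close> if it is nonpositive or if
  paying \<open>lam\<close> is cheaper than moving it to \<open>0\<close>, and take \<open>0\<close> otherwise. Nonemptiness makes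
  \<^const>\<open>infdist\<close> to the set meaningful.
\<close>

lemma Prox_nonempty:
  assumes "\<alpha> > 0" "lam > 0"
  shows "Prox \<alpha> lam z \<noteq> {}"
proof -
  have "\<exists>t. \<forall>t'. coord_cost lam \<alpha> s t \<le> coord_cost lam \<alpha> s t'" for s
  proof (cases "s \<le> 0 \<or> lam \<le> 1 / (2 * \<alpha>) * s\<^sup>2")
    case True
    have "coord_cost lam \<alpha> s s \<le> coord_cost lam \<alpha> s t'" for t'
    proof (cases "0 < s \<and> t' \<le> 0")
      case True
      then have "s\<^sup>2 \<le> (t' - s)\<^sup>2" by (simp add: abs_le_square_iff[symmetric])
      then have "1 / (2 * \<alpha>) * s\<^sup>2 \<le> 1 / (2 * \<alpha>) * (t' - s)\<^sup>2"
        using assms by (intro mult_left_mono) auto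
      with True \<open>s \<le> 0 \<or> _\<close> show ?thesis by (auto simp: coord_cost_def)
    qed (use assms in \<open>auto simp: coord_cost_def\<close>)
    then show ?thesis by blast
  next
    case False
    have "coord_cost lam \<alpha> s 0 \<le> coord_cost lam \<alpha> s t'" for t'
    proof (cases "0 < t'")
      case True
      have "0 \<le> 1 / (2 * \<alpha>) * (t' - s)\<^sup>2" using assms by simp
      with True False show ?thesis by (simp add: coord_cost_def)
    next
      case t': False
      with False have "s\<^sup>2 \<le> (t' - s)\<^sup>2" by (simp add: abs_le_square_iff[symmetric])
      then have "1 / (2 * \<alpha>) * s\<^sup>2 \<le> 1 / (2 * \<alpha>) * (t' - s)\<^sup>2"
        using assms by (intro mult_left_mono) auto
      with t' show ?thesis by (simp add: coord_cost_def)
    qed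
    then show ?thesis by blast
  qed
  then obtain T where "\<And>s t'. coord_cost lam \<alpha> s (T s) \<le> coord_cost lam \<alpha> s t'" by metis
  then have "(\<chi> i. T (z $ i)) \<in> Prox \<alpha> lam z" by (simp add: Prox_iff_coordinatewise)
  then show ?thesis by blast
qed

text \<open>
  Closedness of the proximal inclusion, which carries the approximate criterion (b) to the limit. The
  loss is only lower semicontinuous, and that suffices: a coordinate that is positive in the limit is
  eventually positive, so in the limit the loss of the near minimizers \<open>p k\<close> can only drop, while
  the competitor \<open>t\<close> is fixed.
\<close>

lemma Prox_limit:
  fixes y s :: "nat \<Rightarrow> real^'n"
  assumes "\<alpha> > 0" "lam > 0" and y: "y \<longlonglongrightarrow> Y" and s: "s \<longlonglongrightarrow> S"
    and dist0: "(\<lambda>k. infdist (y k) (Prox \<alpha> lam (s k))) \<longlonglongrightarrow> 0"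
  shows "Y \<in> Prox \<alpha> lam S"
proof -
  let ?D = "\<lambda>k. infdist (y k) (Prox \<alpha> lam (s k)) + 1 / real (Suc k)"
  have "\<exists>p. p \<in> Prox \<alpha> lam (s k) \<and> dist (y k) p < ?D k" for k
  proof -
    have "(INF p\<in>Prox \<alpha> lam (s k). dist (y k) p) < ?D k"
      by (simp add: infdist_notempty[OF Prox_nonempty[OF assms(1,2)], symmetric])
    then show ?thesis
      using Prox_nonempty[OF assms(1,2)] by (subst (asm) cINF_less_iff) auto
  qed
  then obtain p where p: "\<And>k. p k \<in> Prox \<alpha> lam (s k)" "\<And>k. dist (y k) (p k) < ?D k" by metis
  have "(\<lambda>k. 1 / real (Suc k)) \<longlonglongrightarrow> 0"
    using lim_1_over_n by (rule LIMSEQ_Suc)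
  with dist0 have "?D \<longlonglongrightarrow> 0 + 0" by (rule tendsto_add)
  then have D0: "?D \<longlonglongrightarrow> 0" by (simp only: add_0)
  have "(\<lambda>k. dist (y k) (p k)) \<longlonglongrightarrow> 0"
  proof (rule real_tendsto_sandwich[OF _ _ tendsto_const D0])
    show "\<forall>\<^sub>F k in sequentially. dist (y k) (p k) \<le> ?D k"
      by (rule always_eventually) (blast intro: less_imp_le p(2))
  qed simp
  then have "(\<lambda>k. y k - p k) \<longlonglongrightarrow> 0"
    unfolding dist_norm by (rule tendsto_norm_zero_cancel)
  from tendsto_diff[OF y this] have "p \<longlonglongrightarrow> Y" by (simp only: diff_diff_eq2 add_diff_cancel_left' diff_zero)
  then have pi: "(\<lambda>k. p k $ i) \<longlonglongrightarrow> Y $ i" for i by (rule tendsto_vec_nth)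
  have si: "(\<lambda>k. s k $ i) \<longlonglongrightarrow> S $ i" for i using s by (rule tendsto_vec_nth)
  have "coord_cost lam \<alpha> (S $ i) (Y $ i) \<le> coord_cost lam \<alpha> (S $ i) t" for i t
  proof (rule tendsto_le[OF trivial_limit_sequentially])
    show "(\<lambda>k. coord_cost lam \<alpha> (s k $ i) t) \<longlonglongrightarrow> coord_cost lam \<alpha> (S $ i) t"
      unfolding coord_cost_def by (intro tendsto_intros si)
    show "(\<lambda>k. (if 0 < Y $ i then lam else 0) + 1 / (2 * \<alpha>) * (p k $ i - s k $ i)\<^sup>2)
        \<longlonglongrightarrow> coord_cost lam \<alpha> (S $ i) (Y $ i)"
      unfolding coord_cost_def by (intro tendsto_intros si pi)
    have "\<forall>\<^sub>F k in sequentially. 0 < Y $ i \<longrightarrow> 0 < p k $ i"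
      using order_tendstoD(1)[OF pi[of i], of 0] by (cases "0 < Y $ i") auto
    then show "\<forall>\<^sub>F k in sequentially. (if 0 < Y $ i then lam else 0)
        + 1 / (2 * \<alpha>) * (p k $ i - s k $ i)\<^sup>2 \<le> coord_cost lam \<alpha> (s k $ i) t"
    proof eventually_elim
      case (elim k)
      have "coord_cost lam \<alpha> (s k $ i) (p k $ i) \<le> coord_cost lam \<alpha> (s k $ i) t"
        using p(1)[of k] by (simp add: Prox_iff_coordinatewise)
      then show ?case using elim \<open>lam > 0\<close> by (auto simp: coord_cost_def split: if_splits)
    qed
  qed
  then show ?thesis by (simp add: Prox_iff_coordinatewise)
qed

text \<open>
  Perturb one coordinate without changing its status (positive or not). The loss is unaffected, so
  the smooth quadratic alone must not decrease. Away from \<open>0\<close> both directions are allowed, which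
  forces \<open>z $ i = 0\<close>; at \<open>0\<close> only negative perturbations are, which leaves a sign condition.
\<close>

lemma Prox_multiplier_signs:
  assumes "\<alpha> > 0" and fix_pt: "u \<in> Prox \<alpha> lam (u + \<alpha> *\<^sub>R z)"
  shows "u $ i \<noteq> 0 \<Longrightarrow> z $ i = 0" and "u $ i = 0 \<Longrightarrow> 0 \<le> z $ i"
proof -
  let ?c = "\<alpha> * z $ i"
  have step: "0 \<le> s\<^sup>2 - 2 * s * ?c" if "0 < u $ i + s \<longleftrightarrow> 0 < u $ i" for s
  proof -
    have "coord_cost lam \<alpha> (u $ i + ?c) (u $ i) \<le> coord_cost lam \<alpha> (u $ i + ?c) (u $ i + s)"
      using fix_pt by (simp add: Prox_iff_coordinatewise)
    then have "1 / (2 * \<alpha>) * ?c\<^sup>2 \<le> 1 / (2 * \<alpha>) * (s - ?c)\<^sup>2"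
      using that by (simp add: coord_cost_def)
    then have "?c\<^sup>2 \<le> (s - ?c)\<^sup>2"
      using \<open>\<alpha> > 0\<close> by (subst (asm) mult_le_cancel_left_pos) auto
    then show ?thesis by (simp add: power2_diff mult.assoc)
  qed
  show "z $ i = 0" if "u $ i \<noteq> 0"
  proof (rule ccontr)
    assume "z $ i \<noteq> 0"
    then have c: "?c \<noteq> 0" using \<open>\<alpha> > 0\<close> by simp
    \<comment> \<open>a move towards \<open>?c\<close> that neither overshoots \<open>?c\<close> nor changes the sign of \<open>u $ i\<close>\<close>
    define r where "r = min \<bar>?c\<bar> (\<bar>u $ i\<bar> / 2)"
    have r: "0 < r" "r \<le> \<bar>?c\<bar>" "r < \<bar>u $ i\<bar>" using c that by (auto simp: r_def)
    have "0 \<le> (sgn ?c * r)\<^sup>2 - 2 * (sgn ?c * r) * ?c"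
      using r by (intro step) (auto simp: sgn_real_def)
    also have "\<dots> = r\<^sup>2 - 2 * r * \<bar>?c\<bar>"
      using c by (auto simp: power_mult_distrib sgn_real_def)
    also have "\<dots> \<le> r * r - 2 * r * r" using r by (simp add: power2_eq_square)
    also have "\<dots> < 0" using r by simp
    finally show False by simp
  qed
  show "0 \<le> z $ i" if "u $ i = 0"
  proof (rule ccontr)
    assume "\<not> 0 \<le> z $ i"
    then have c: "?c < 0" using \<open>\<alpha> > 0\<close> by (simp add: mult_pos_neg)
    have "0 \<le> ?c\<^sup>2 - 2 * ?c * ?c" using c that by (intro step) auto
    moreover have "0 < ?c * ?c" by (rule mult_neg_neg[OF c c])
    ultimately show False by (simp only: power2_eq_square mult.assoc)
  qed
qed

section \<open>P-stationary points\<close>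

text \<open>
  By complementarity the multiplier \<open>z\<close> is supported where \<open>u\<close> vanishes. If two stationary points
  have the same zero set, then \<open>z\<close> is orthogonal to the difference of the \<open>u\<close> parts, so each \<open>w\<close>
  minimizes \<open>f\<close> over the affine space of points whose constraint values vanish on that set. Strong
  convexity allows only one such minimizer.
\<close>

lemma stationary_determined_by_zero_set:
  fixes A :: "real^'p^'n"
  assumes sc: "\<And>x y. f x + grad f x \<bullet> (y - x) + \<sigma> / 2 * (norm (y - x))\<^sup>2 \<le> f y"
    and "\<sigma> > 0"
    and st1: "P_stationary f lam A b w1 u1 z1" and st2: "P_stationary f lam A b w2 u2 z2"
    and same: "{i. u1 $ i = 0} = {i. u2 $ i = 0}"
  shows "w1 = w2"
proof -
  have le: "f w + \<sigma> / 2 * (norm (w' - w))\<^sup>2 \<le> f w'"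
    if st: "P_stationary f lam A b w u z" "P_stationary f lam A b w' u' z'"
      and same: "{i. u $ i = 0} = {i. u' $ i = 0}" for w w' u u' z z'
  proof -
    obtain \<alpha> where "\<alpha> > 0" "grad f w + transpose A *v z = 0" "u \<in> Prox \<alpha> lam (u + \<alpha> *\<^sub>R z)"
      using st(1) unfolding P_stationary_def by blast
    have "z \<bullet> (u' - u) = 0"
      unfolding inner_vec_def
    proof (intro sum.neutral ballI)
      fix i
      show "z $ i \<bullet> (u' - u) $ i = 0"
        using Prox_multiplier_signs(1)[OF \<open>\<alpha> > 0\<close> \<open>u \<in> _\<close>, of i] same by (cases "u $ i = 0") auto
    qed
    moreover have "u' - u = A *v (w' - w)"
      using st by (auto simp: P_stationary_def matrix_vector_mult_diff_distrib algebra_simps)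
    moreover have "grad f w = - (transpose A *v z)"
      using \<open>grad f w + _ = 0\<close> by (simp add: eq_neg_iff_add_eq_0)
    ultimately have "grad f w \<bullet> (w' - w) = 0" by (simp add: inner_transpose del: transpose_matrix_vector)
    with sc[of w w'] show ?thesis by simp
  qed
  have "\<sigma> * (norm (w1 - w2))\<^sup>2 \<le> 0"
    using le[OF st1 st2 same] le[OF st2 st1 same[symmetric]] by (simp add: norm_minus_commute)
  with \<open>\<sigma> > 0\<close> show ?thesis by (simp add: mult_le_0_iff)
qed

text \<open>
  The zero set is one of finitely many subsets of the index type and determines the point. This
  finiteness is what upgrades subsequential convergence of the algorithm to convergence.
\<close>

lemma finite_stationary_points:
  fixes A :: "real^'p^'n"
  assumes sc: "\<And>x y. f x + grad f x \<bullet> (y - x) + \<sigma> / 2 * (norm (y - x))\<^sup>2 \<le> f y"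
    and "\<sigma> > 0"
  shows "finite {w. \<exists>u z. P_stationary f lam A b w u z}" (is "finite ?S")
proof -
  obtain U Z where UZ: "\<And>w. w \<in> ?S \<Longrightarrow> P_stationary f lam A b w (U w) (Z w)"
  proof -
    have "\<exists>q. w \<in> ?S \<longrightarrow> P_stationary f lam A b w (fst q) (snd q)" for w by auto
    then obtain q where "\<And>w. w \<in> ?S \<longrightarrow> P_stationary f lam A b w (fst (q w)) (snd (q w))" by metis
    then show thesis using that[of "fst \<circ> q" "snd \<circ> q"] by simp
  qed
  have "inj_on (\<lambda>w. {i. U w $ i = 0}) ?S"
    by (rule inj_onI) (rule stationary_determined_by_zero_set[OF sc \<open>\<sigma> > 0\<close> UZ UZ])
  then show ?thesis by (rule inj_on_finite[of _ _ UNIV]) auto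
qed

text \<open>
  Close to \<open>u\<close> the nonzero coordinates keep their signs and \<open>f\<close> changes by less than \<open>lam\<close>.
  If a zero coordinate becomes positive, the loss grows by at least \<open>lam\<close> and pays for every decrease
  of \<open>f\<close>. Otherwise all zero coordinates become nonpositive, where \<open>z \<ge> 0\<close>, and convexity of
  \<open>f\<close> together with \<open>grad f w = - (transpose A *v z)\<close> shows that \<open>f\<close> does not decrease.
\<close>

lemma stationary_imp_local_minimizer:
  fixes A :: "real^'p^'n"
  assumes cvx: "\<And>x y. f x + grad f x \<bullet> (y - x) \<le> f y" and cont: "isCont f w"
    and "lam > 0" and st: "P_stationary f lam A b w u z"
  shows "local_minimizer (objective f lam) (feasible_set A b) (w, u)"
proof -
  obtain \<alpha> where "\<alpha> > 0" and g0: "grad f w + transpose A *v z = 0"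
    and fix_pt: "u \<in> Prox \<alpha> lam (u + \<alpha> *\<^sub>R z)" and feas: "A *v w + b - u = 0"
    using st unfolding P_stationary_def by blast
  note signs = Prox_multiplier_signs[OF \<open>\<alpha> > 0\<close> fix_pt]
  let ?near = "\<lambda>(w', u'). \<bar>f w' - f w\<bar> < lam
    \<and> (\<forall>i. (0 < u $ i \<longrightarrow> 0 < u' $ i) \<and> (u $ i < 0 \<longrightarrow> u' $ i < 0))"
  have "\<forall>\<^sub>F q in nhds (w, u). ?near q"
  proof -
    have "((\<lambda>q. f (fst q)) \<longlongrightarrow> f w) (nhds (w, u))"
      using tendsto_fst[OF filterlim_ident, of "(w, u)"] by (intro isCont_tendsto_compose[OF cont]) simp
    then have "\<forall>\<^sub>F q in nhds (w, u). \<bar>f (fst q) - f w\<bar> < lam"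
      using \<open>lam > 0\<close> by (auto dest!: tendstoD simp: dist_real_def)
    moreover have "\<forall>\<^sub>F q in nhds (w, u). \<forall>i.
        (0 < u $ i \<longrightarrow> 0 < snd q $ i) \<and> (u $ i < 0 \<longrightarrow> snd q $ i < 0)"
    proof (rule eventually_all_finite)
      fix i
      have lim: "((\<lambda>q. snd q $ i) \<longlongrightarrow> u $ i) (nhds (w, u))"
        using tendsto_snd[OF filterlim_ident, of "(w, u)"] by (intro tendsto_vec_nth) simp
      show "\<forall>\<^sub>F q in nhds (w, u). (0 < u $ i \<longrightarrow> 0 < snd q $ i) \<and> (u $ i < 0 \<longrightarrow> snd q $ i < 0)"
        using order_tendstoD(1)[OF lim, of 0] order_tendstoD(2)[OF lim, of 0]
        by (cases "u $ i = 0"; cases "0 < u $ i") auto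
    qed
    ultimately show ?thesis by eventually_elim auto
  qed
  then obtain r where "r > 0" and r: "\<And>q. dist q (w, u) < r \<Longrightarrow> ?near q"
    unfolding eventually_nhds_metric by auto
  have min: "f w + zero_one_loss lam u \<le> f w' + zero_one_loss lam u'"
    if feas': "A *v w' + b = u'" and near: "?near (w', u')" for w' u'
  proof -
    let ?P = "{i. 0 < u $ i}" and ?P' = "{i. 0 < u' $ i}"
    have sub: "?P \<subseteq> ?P'" using near by auto
    show ?thesis
    proof (cases "?P = ?P'")
      case False
      with sub have "card ?P < card ?P'" by (intro psubset_card_mono) auto
      then have "lam * real (card ?P) + lam \<le> lam * real (card ?P')"
        using \<open>lam > 0\<close> mult_left_mono[of "real (card ?P) + 1" "real (card ?P')" lam]
        by (simp add: algebra_simps)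
      then show ?thesis using near by (auto simp: zero_one_loss_def norm0_pos_part)
    next
      case True
      have "z \<bullet> (u' - u) \<le> 0"
        unfolding inner_vec_def
      proof (intro sum_nonpos)
        fix i
        show "z $ i \<bullet> (u' - u) $ i \<le> 0"
        proof (cases "u $ i = 0")
          case zero: True
          with True have "u' $ i \<le> 0" by (metis (mono_tags, lifting) less_irrefl mem_Collect_eq not_le)
          with zero signs(2)[OF zero] show ?thesis by (simp add: mult_nonneg_nonpos)
        qed (simp add: signs(1))
      qed
      moreover have "u' - u = A *v (w' - w)"
        using feas feas' by (auto simp: matrix_vector_mult_diff_distrib algebra_simps)
      moreover have "grad f w = - (transpose A *v z)"
        using g0 by (simp add: eq_neg_iff_add_eq_0)
      ultimately have "0 \<le> grad f w \<bullet> (w' - w)"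
        by (simp add: inner_transpose del: transpose_matrix_vector)
      with cvx[of w w'] have "f w \<le> f w'" by simp
      with True show ?thesis by (simp add: zero_one_loss_def norm0_pos_part)
    qed
  qed
  show ?thesis
    unfolding local_minimizer_def
  proof (intro conjI exI[of _ r] ballI)
    show "(w, u) \<in> feasible_set A b" using feas by (simp add: feasible_set_def)
    fix q assume "q \<in> feasible_set A b \<inter> ball (w, u) r"
    then obtain w' u' where q: "q = (w', u')" "A *v w' + b = u'" "dist q (w, u) < r"
      by (auto simp: feasible_set_def dist_commute)
    then have "?near (w', u')" using r by blast
    with min[OF q(2)] q(1) show "objective f lam (w, u) \<le> objective f lam q"
      by (simp add: objective_def)
  qed (rule \<open>r > 0\<close>)
qed

section \<open>Two convergence criteria\<close>

text \<open>
  By compactness the sequence is eventually within a third of the minimal separation of \<open>S\<close>. Steps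
  that are also shorter than a third cannot lead from one point of \<open>S\<close> to the neighbourhood of another.
\<close>

lemma converges_if_finitely_many_limit_points:
  fixes x :: "nat \<Rightarrow> 'a::heine_borel"
  assumes bdd: "bounded (range x)" and step: "(\<lambda>k. dist (x (Suc k)) (x k)) \<longlonglongrightarrow> 0"
    and "finite S"
    and lim_pts: "\<And>r l. strict_mono r \<Longrightarrow> (x \<circ> r) \<longlonglongrightarrow> l \<Longrightarrow> l \<in> S"
  shows "\<exists>l\<in>S. x \<longlonglongrightarrow> l"
proof -
  have near: "\<forall>\<^sub>F k in sequentially. \<exists>s\<in>S. dist (x k) s < e" if "e > 0" for e
  proof (rule ccontr)
    assume "\<not> ?thesis"
    then have "infinite {k. \<not> (\<exists>s\<in>S. dist (x k) s < e)}"
      by (simp add: cofinite_eq_sequentially[symmetric] eventually_cofinite)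
    from infinite_enumerate[OF this] obtain r :: "nat \<Rightarrow> nat" where r: "strict_mono r"
      and far: "\<forall>n. r n \<in> {k. \<not> (\<exists>s\<in>S. dist (x k) s < e)}" by blast
    have "bounded (range (x \<circ> r))" using bdd by (rule bounded_subset) (simp only: image_comp[symmetric] image_mono subset_UNIV)
    from bounded_imp_convergent_subsequence[OF this]
    obtain l q where q: "strict_mono q" "((x \<circ> r) \<circ> q) \<longlonglongrightarrow> l" by blast
    have "l \<in> S" using lim_pts[OF strict_mono_o[OF r q(1)]] q(2) by (simp add: o_assoc)
    moreover have "\<forall>\<^sub>F n in sequentially. dist (((x \<circ> r) \<circ> q) n) l < e"
      using q(2) \<open>e > 0\<close> by (rule tendstoD)
    then obtain n where "dist (x (r (q n))) l < e"
      by (auto simp: eventually_sequentially)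
    ultimately show False using far by blast
  qed
  \<comment> \<open>\<open>1\<close> keeps the set nonempty when \<open>S\<close> has fewer than two points\<close>
  define D where "D = insert 1 {dist s s' |s s'. s \<in> S \<and> s' \<in> S \<and> s \<noteq> s'}"
  have "{dist s s' |s s'. s \<in> S \<and> s' \<in> S \<and> s \<noteq> s'} \<subseteq> (\<lambda>(s, s'). dist s s') ` (S \<times> S)" by auto
  then have "finite D" unfolding D_def using \<open>finite S\<close> by (simp add: finite_subset)
  define \<delta> where "\<delta> = Min D"
  have "\<delta> > 0" using \<open>finite D\<close> unfolding \<delta>_def by (subst Min_gr_iff) (auto simp: D_def)
  have sep: "s = s'" if "s \<in> S" "s' \<in> S" "dist s s' < \<delta>" for s s'
  proof (rule ccontr)
    assume "s \<noteq> s'"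
    then have "dist s s' \<in> D" using that by (auto simp: D_def)
    then have "\<delta> \<le> dist s s'" unfolding \<delta>_def using \<open>finite D\<close> by (intro Min_le)
    with that show False by simp
  qed
  have "\<forall>\<^sub>F k in sequentially. dist (x (Suc k)) (x k) < \<delta> / 3"
    using order_tendstoD(2)[OF step, of "\<delta> / 3"] \<open>\<delta> > 0\<close> by simp
  moreover have "\<forall>\<^sub>F k in sequentially. \<exists>s\<in>S. dist (x k) s < \<delta> / 3"
    using \<open>\<delta> > 0\<close> by (intro near) simp
  ultimately have "\<forall>\<^sub>F k in sequentially. (\<exists>s\<in>S. dist (x k) s < \<delta> / 3)
      \<and> dist (x (Suc k)) (x k) < \<delta> / 3"
    by eventually_elim auto
  then obtain N where N: "\<And>k. k \<ge> N \<Longrightarrow> \<exists>s\<in>S. dist (x k) s < \<delta> / 3"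
      "\<And>k. k \<ge> N \<Longrightarrow> dist (x (Suc k)) (x k) < \<delta> / 3"
    unfolding eventually_sequentially by blast
  obtain l where l: "l \<in> S" "dist (x N) l < \<delta> / 3" using N(1) by blast
  have stay: "dist (x k) l < \<delta> / 3" if "k \<ge> N" for k
    using that
  proof (induction k rule: dec_induct)
    case (step k)
    obtain s where s: "s \<in> S" "dist (x (Suc k)) s < \<delta> / 3" using N(1)[of "Suc k"] step by auto
    have "dist s l \<le> dist s (x (Suc k)) + dist (x (Suc k)) (x k) + dist (x k) l"
      by metric
    then have "dist s l < \<delta>" using s(2) N(2)[of k] step by (simp add: dist_commute)
    then show ?case using sep[OF s(1) l(1)] s(2) by simp
  qed (use l in simp)
  have "x \<longlonglongrightarrow> l"
  proof (rule tendstoI)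
    fix e :: real assume "e > 0"
    then have "\<forall>\<^sub>F k in sequentially. \<exists>s\<in>S. dist (x k) s < min e (\<delta> / 3)"
      using \<open>\<delta> > 0\<close> by (intro near) simp
    with eventually_ge_at_top[of N] show "\<forall>\<^sub>F k in sequentially. dist (x k) l < e"
    proof eventually_elim
      case (elim k)
      then obtain s where s: "s \<in> S" "dist (x k) s < min e (\<delta> / 3)" by blast
      have "dist s l \<le> dist s (x k) + dist (x k) l" by metric
      then have "dist s l < \<delta>" using s(2) stay[of k] elim \<open>\<delta> > 0\<close> by (simp add: dist_commute)
      then show ?case using sep[OF s(1) l(1)] s(2) by simp
    qed
  qed
  with l show ?thesis by blast
qed

lemma converges_if_bounded_below_image_converges:
  fixes A :: "real^'p^'n" and q :: "nat \<Rightarrow> real^'p"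
  assumes "\<gamma> > 0" and below: "\<And>p. \<gamma> * norm p \<le> norm (A *v p)"
    and lim: "(\<lambda>k. A *v q k) \<longlonglongrightarrow> c"
  obtains p where "q \<longlonglongrightarrow> p" "A *v p = c"
proof -
  have "Cauchy q"
  proof (rule metric_CauchyI)
    fix e :: real assume "e > 0"
    then have "0 < \<gamma> * e" using \<open>\<gamma> > 0\<close> by simp
    with LIMSEQ_imp_Cauchy[OF lim] obtain N
      where N: "\<And>m n. m \<ge> N \<Longrightarrow> n \<ge> N \<Longrightarrow> dist (A *v q m) (A *v q n) < \<gamma> * e"
      unfolding Cauchy_def by blast
    have "dist (q m) (q n) < e" if "m \<ge> N" "n \<ge> N" for m n
    proof -
      have "\<gamma> * norm (q m - q n) < \<gamma> * e"
        using below[of "q m - q n"] N[OF that]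
        by (simp add: dist_norm matrix_vector_mult_diff_distrib)
      then show ?thesis using \<open>\<gamma> > 0\<close> by (simp add: dist_norm)
    qed
    then show "\<exists>N. \<forall>m\<ge>N. \<forall>n\<ge>N. dist (q m) (q n) < e" by blast
  qed
  then obtain p where p: "q \<longlonglongrightarrow> p" by (metis Cauchy_convergent convergentD)
  have "(\<lambda>k. A *v q k) \<longlonglongrightarrow> A *v p"
    by (rule isCont_tendsto_compose[OF matrix_vector_mult_linear_continuous_at p])
  with lim have "A *v p = c" by (rule LIMSEQ_unique[rotated])
  with p that show thesis by blast
qed

section \<open>Descent of the Lyapunov energy\<close>

lemma sum_4_power2_le:
  fixes a b c d :: real
  shows "(a + b + c + d)\<^sup>2 \<le> 4 * (a\<^sup>2 + b\<^sup>2 + c\<^sup>2 + d\<^sup>2)"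
proof -
  have "0 \<le> (a-b)\<^sup>2 + (a-c)\<^sup>2 + (a-d)\<^sup>2 + (b-c)\<^sup>2 + (b-d)\<^sup>2 + (c-d)\<^sup>2" by simp
  then show ?thesis by (simp add: power2_eq_square algebra_simps)
qed

lemma sum_3_power2_le:
  fixes a b c :: real
  shows "(a + b + c)\<^sup>2 \<le> 3 * (a\<^sup>2 + b\<^sup>2 + c\<^sup>2)"
proof -
  have "0 \<le> (a-b)\<^sup>2 + (a-c)\<^sup>2 + (b-c)\<^sup>2" by simp
  then show ?thesis by (simp add: power2_eq_square algebra_simps)
qed

text \<open>
  The iteration after its first round: \<open>x k\<close>, \<open>y k\<close>, \<open>q k\<close> stand for \<open>w (Suc k)\<close>,
  \<open>u (Suc k)\<close>, \<open>z (Suc k)\<close>. The shift matters because the initial proximal centre is arbitrary,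
  and only from then on is the centre the previous iterate. The multiplier step has already been used to
  rewrite criterion (b): the partial gradients of the subproblem at the new iterate are
  \<open>grad f w + \<mu> *\<^sub>R (w - v) + transpose A *v z\<close> and \<open>- z\<close> with the updated multiplier \<open>z\<close>.
  The index of \<open>e\<close> is that of the old iterate.
\<close>

locale ialm_tail =
  fixes f :: "real^'p \<Rightarrow> real" and A :: "real^'p^'n" and b :: "real^'n"
    and lam \<rho> \<mu> \<gamma> l \<sigma> :: real
    and x :: "nat \<Rightarrow> real^'p" and y q :: "nat \<Rightarrow> real^'n" and e :: "nat \<Rightarrow> real"
  assumes lam: "lam > 0" and \<rho>: "\<rho> > 0" and \<mu>: "\<mu> > 0" and \<gamma>: "\<gamma> > 0" and \<sigma>: "\<sigma> > 0"
    and gr: "\<And>x. GDERIV f x :> grad f x"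
    and lip: "l-lipschitz_on UNIV (grad f)"
    and sc: "\<And>x y. f x + grad f x \<bullet> (y - x) + \<sigma> / 2 * (norm (y - x))\<^sup>2 \<le> f y"
    and below: "\<And>p. \<gamma> * norm p \<le> norm (transpose A *v p)"
    and rho_prox: "16 * (((\<mu> + l) / \<gamma>)\<^sup>2 + (\<mu> / \<gamma>)\<^sup>2) \<le> \<rho> * \<mu>"
    and rho_smooth: "6 * l \<le> \<rho> * \<gamma>\<^sup>2"
    and e: "summable (\<lambda>k. (e k)\<^sup>2)"
    and dual: "\<And>k. norm (grad f (x (Suc k)) + \<mu> *\<^sub>R (x (Suc k) - x k)
                   + transpose A *v q (Suc k)) \<le> e k"
    and prox: "\<And>k. infdist (y (Suc k))
                 (Prox (1 / \<rho>) lam (y (Suc k) + (1 / \<rho>) *\<^sub>R q (Suc k))) \<le> e k"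
    and mult: "\<And>k. q (Suc k) = q k + \<rho> *\<^sub>R (A *v x (Suc k) + b - y (Suc k))"
    and decr: "\<And>k. lyapunov f lam A b \<rho> \<mu> (x (Suc k)) (y (Suc k)) (q k) (x k)
                 \<le> lyapunov f lam A b \<rho> \<mu> (x k) (y k) (q k) (x k)"
begin

definition step_length :: "nat \<Rightarrow> real" where "step_length k = norm (x (Suc k) - x k)"

definition c1 :: real where "c1 = (\<mu> + l) / \<gamma>"
definition c2 :: real where "c2 = \<mu> / \<gamma>"

text \<open>
  The augmented Lagrangian at the current iterate, plus a multiple of the last squared step. The
  multiplier update raises the augmented Lagrangian by an amount that depends on the last two
  steps; the extra term stores the share of the older one.
\<close>

definition energy :: "nat \<Rightarrow> real" where
  "energy k = lyapunov f lam A b \<rho> \<mu> (x (Suc k)) (y (Suc k)) (q (Suc k)) (x (Suc k))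
     + 4 * c2\<^sup>2 / \<rho> * (step_length k)\<^sup>2"

text \<open>
  Subtract two consecutive approximate optimality conditions in \<open>w\<close>. This expresses
  \<open>transpose A\<close> applied to the multiplier step by quantities that are Lipschitz in the steps of
  \<open>x\<close>, and \<open>transpose A\<close> is bounded below by \<open>\<gamma>\<close>.
\<close>

lemma multiplier_step_bound:
  "(norm (q (Suc (Suc k)) - q (Suc k)))\<^sup>2
     \<le> 4 * (c1\<^sup>2 * (step_length (Suc k))\<^sup>2 + c2\<^sup>2 * (step_length k)\<^sup>2 + ((e (Suc k))\<^sup>2 + (e k)\<^sup>2) / \<gamma>\<^sup>2)"
proof -
  let ?R = "\<lambda>k. grad f (x (Suc k)) + \<mu> *\<^sub>R (x (Suc k) - x k) + transpose A *v q (Suc k)"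
  let ?N = "norm (q (Suc (Suc k)) - q (Suc k))"
  let ?g = "grad f (x (Suc (Suc k))) - grad f (x (Suc k))"
  have tri: "norm (r - r' - g - s + s') \<le> norm r + norm r' + norm g + norm s + norm s'"
    for r r' g s s' :: "real^'p" by norm
  have "transpose A *v (q (Suc (Suc k)) - q (Suc k)) = ?R (Suc k) - ?R k - ?g
      - \<mu> *\<^sub>R (x (Suc (Suc k)) - x (Suc k)) + \<mu> *\<^sub>R (x (Suc k) - x k)"
    unfolding matrix_vector_mult_diff_distrib by (simp del: transpose_matrix_vector)
  then have "norm (transpose A *v (q (Suc (Suc k)) - q (Suc k)))
      \<le> norm (?R (Suc k)) + norm (?R k) + norm ?g
      + norm (\<mu> *\<^sub>R (x (Suc (Suc k)) - x (Suc k))) + norm (\<mu> *\<^sub>R (x (Suc k) - x k))"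
    using tri by (simp only:)
  also have "\<dots> \<le> e (Suc k) + e k + l * step_length (Suc k) + \<mu> * step_length (Suc k) + \<mu> * step_length k"
  proof -
    have "norm ?g \<le> l * step_length (Suc k)"
      using lipschitz_onD[OF lip, of "x (Suc (Suc k))" "x (Suc k)"] by (simp add: step_length_def dist_norm)
    moreover have "norm (\<mu> *\<^sub>R (x (Suc (Suc k)) - x (Suc k))) = \<mu> * step_length (Suc k)"
      and "norm (\<mu> *\<^sub>R (x (Suc k) - x k)) = \<mu> * step_length k"
      using \<mu> by (simp_all add: step_length_def)
    ultimately show ?thesis using dual[of k] dual[of "Suc k"] by linarith
  qed
  finally have "\<gamma> * ?N \<le> (\<mu> + l) * step_length (Suc k) + \<mu> * step_length k + e (Suc k) + e k"
    using below[of "q (Suc (Suc k)) - q (Suc k)"] by (simp add: algebra_simps)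
  then have "?N \<le> ((\<mu> + l) * step_length (Suc k) + \<mu> * step_length k + e (Suc k) + e k) / \<gamma>"
    using \<gamma> by (simp add: pos_le_divide_eq mult.commute)
  also have "\<dots> = c1 * step_length (Suc k) + c2 * step_length k + e (Suc k) / \<gamma> + e k / \<gamma>"
    using \<gamma> by (simp add: c1_def c2_def field_simps)
  finally have "?N\<^sup>2 \<le> (c1 * step_length (Suc k) + c2 * step_length k + e (Suc k) / \<gamma> + e k / \<gamma>)\<^sup>2"
    by (rule power_mono) simp
  also have "\<dots> \<le> 4 * ((c1 * step_length (Suc k))\<^sup>2 + (c2 * step_length k)\<^sup>2 + (e (Suc k) / \<gamma>)\<^sup>2 + (e k / \<gamma>)\<^sup>2)"
    by (rule sum_4_power2_le)
  finally show ?thesis by (simp add: power_mult_distrib power_divide add_divide_distrib)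
qed

lemma multiplier_bound:
  "(norm (q (Suc k)))\<^sup>2
     \<le> 3 / \<gamma>\<^sup>2 * ((e k)\<^sup>2 + (norm (grad f (x (Suc k))))\<^sup>2) + 3 * c2\<^sup>2 * (step_length k)\<^sup>2"
proof -
  let ?R = "grad f (x (Suc k)) + \<mu> *\<^sub>R (x (Suc k) - x k) + transpose A *v q (Suc k)"
  let ?G = "norm (grad f (x (Suc k)))"
  have tri: "norm (r - g - s) \<le> norm r + norm g + norm s" for r g s :: "real^'p" by norm
  have "transpose A *v q (Suc k) = ?R - grad f (x (Suc k)) - \<mu> *\<^sub>R (x (Suc k) - x k)" by simp
  also have "norm \<dots> \<le> norm ?R + ?G + norm (\<mu> *\<^sub>R (x (Suc k) - x k))" by (rule tri)
  also have "\<dots> \<le> e k + ?G + \<mu> * step_length k" using dual[of k] \<mu> by (simp add: step_length_def)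
  finally have "\<gamma> * norm (q (Suc k)) \<le> e k + ?G + \<mu> * step_length k" using below order_trans by blast
  then have "norm (q (Suc k)) \<le> (e k + ?G + \<mu> * step_length k) / \<gamma>"
    using \<gamma> by (simp add: pos_le_divide_eq mult.commute)
  also have "\<dots> = e k / \<gamma> + ?G / \<gamma> + c2 * step_length k" by (simp add: c2_def add_divide_distrib)
  finally have "(norm (q (Suc k)))\<^sup>2 \<le> (e k / \<gamma> + ?G / \<gamma> + c2 * step_length k)\<^sup>2"
    by (rule power_mono) simp
  also have "\<dots> \<le> 3 * ((e k / \<gamma>)\<^sup>2 + (?G / \<gamma>)\<^sup>2 + (c2 * step_length k)\<^sup>2)" by (rule sum_3_power2_le)
  finally show ?thesis by (simp add: power_mult_distrib power_divide algebra_simps)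
qed

text \<open>
  The proximal term gains \<open>\<mu> / 2\<close> times the squared step. The multiplier update loses
  \<open>1 / \<rho>\<close> times the squared multiplier step, which together with the stored term costs at most
  \<open>4 * (c1\<^sup>2 + c2\<^sup>2) / \<rho>\<close> times the squared step and an error. The size of \<open>\<rho>\<close> makes this
  cost at most half of the gain.
\<close>

lemma energy_decrease:
  "energy (Suc k) + \<mu> / 4 * (step_length (Suc k))\<^sup>2
     \<le> energy k + 4 / (\<rho> * \<gamma>\<^sup>2) * ((e (Suc k))\<^sup>2 + (e k)\<^sup>2)"
proof -
  define V where "V = lyapunov f lam A b \<rho> \<mu>"
  let ?x1 = "x (Suc k)" and ?x2 = "x (Suc (Suc k))"
  let ?y1 = "y (Suc k)" and ?y2 = "y (Suc (Suc k))"
  let ?q1 = "q (Suc k)" and ?q2 = "q (Suc (Suc k))"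
  let ?N = "norm (?q2 - ?q1)"
  define D E where "D = (step_length (Suc k))\<^sup>2" and "E = ((e (Suc k))\<^sup>2 + (e k)\<^sup>2) / \<gamma>\<^sup>2"
  have res: "A *v ?x2 + b - ?y2 = (1 / \<rho>) *\<^sub>R (?q2 - ?q1)" using mult[of "Suc k"] \<rho> by simp
  have "(?q2 - ?q1) \<bullet> (A *v ?x2 + b - ?y2) = ?N\<^sup>2 / \<rho>"
    unfolding res inner_scaleR_right power2_norm_eq_inner by simp
  then have "?q2 \<bullet> (A *v ?x2 + b - ?y2) = ?q1 \<bullet> (A *v ?x2 + b - ?y2) + ?N\<^sup>2 / \<rho>"
    unfolding inner_diff_left by linarith
  then have "V ?x2 ?y2 ?q2 ?x2 = V ?x2 ?y2 ?q1 ?x1 - \<mu> / 2 * D + ?N\<^sup>2 / \<rho>"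
    by (simp add: V_def D_def lyapunov_def step_length_def)
  also have "\<dots> \<le> V ?x1 ?y1 ?q1 ?x1 - \<mu> / 2 * D + ?N\<^sup>2 / \<rho>"
    using decr[of "Suc k"] by (simp add: V_def)
  also have "?N\<^sup>2 / \<rho> \<le> 4 * (c1\<^sup>2 * D + c2\<^sup>2 * (step_length k)\<^sup>2 + E) / \<rho>"
    unfolding D_def E_def using \<rho> multiplier_step_bound[of k] by (intro divide_right_mono) auto
  finally have 1: "V ?x2 ?y2 ?q2 ?x2 + 4 * c2\<^sup>2 / \<rho> * D + \<mu> / 4 * D
      \<le> V ?x1 ?y1 ?q1 ?x1 + 4 * c2\<^sup>2 / \<rho> * (step_length k)\<^sup>2 + 4 / \<rho> * E
        + (4 * (c1\<^sup>2 + c2\<^sup>2) / \<rho> - \<mu> / 4) * D"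
    by (simp add: add_divide_distrib algebra_simps)
  have "4 * (c1\<^sup>2 + c2\<^sup>2) / \<rho> - \<mu> / 4 \<le> 0"
    using rho_prox \<rho> by (simp add: c1_def c2_def field_simps)
  then have "(4 * (c1\<^sup>2 + c2\<^sup>2) / \<rho> - \<mu> / 4) * D \<le> 0"
    by (rule mult_nonpos_nonneg) (simp add: D_def)
  with 1 show ?thesis by (simp add: energy_def V_def D_def E_def)
qed

text \<open>
  Completing the square in the augmented Lagrangian leaves \<open>f\<close> minus a multiple of
  \<open>(norm (q (Suc k)))\<^sup>2\<close>. By the optimality condition that multiple is at most a share of the squared gradient
  of \<open>f\<close>, hence of \<open>f - m\<close>, plus terms in the last step and the error.
\<close>

lemma energy_lower_bound:
  assumes low: "\<And>x. m \<le> f x"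
  shows "(f (x (Suc k)) + m) / 2 \<le> energy k + 3 / (2 * \<rho> * \<gamma>\<^sup>2) * (e k)\<^sup>2"
proof -
  \<comment> \<open>the smoothness constant for which the gradient term costs exactly \<open>(f - m) / 2\<close>;
    unlike \<open>l\<close> it is visibly positive\<close>
  define L where "L = \<rho> * \<gamma>\<^sup>2 / 6"
  have "L > 0" using \<rho> \<gamma> by (simp add: L_def)
  have "L-lipschitz_on UNIV (grad f)"
    using rho_smooth by (intro lipschitz_on_le[OF lip]) (simp add: L_def)
  then have G: "(norm (grad f (x (Suc k))))\<^sup>2 \<le> 2 * L * (f (x (Suc k)) - m)"
    by (rule gradient_norm_le_gap[OF gr _ \<open>L > 0\<close> low])
  let ?r = "A *v x (Suc k) + b - y (Suc k)" and ?q = "q (Suc k)"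
  have loss: "0 \<le> zero_one_loss lam (y (Suc k))" using lam by (simp add: zero_one_loss_def)
  have square: "(norm (p + \<rho> *\<^sub>R r))\<^sup>2 / (2 * \<rho>)
      = (norm p)\<^sup>2 / (2 * \<rho>) + p \<bullet> r + \<rho> / 2 * (norm r)\<^sup>2" for p r :: "real^'n"
    unfolding power2_norm_eq_inner using \<rho>
    by (simp add: inner_add_left inner_add_right inner_commute[of r p] field_simps)
  have "0 \<le> (norm (?q + \<rho> *\<^sub>R ?r))\<^sup>2 / (2 * \<rho>)" using \<rho> by simp
  also have "\<dots> = (norm ?q)\<^sup>2 / (2 * \<rho>) + ?q \<bullet> ?r + \<rho> / 2 * (norm ?r)\<^sup>2"
    by (rule square)
  finally have "f (x (Suc k)) - (norm ?q)\<^sup>2 / (2 * \<rho>) + 4 * c2\<^sup>2 / \<rho> * (step_length k)\<^sup>2 \<le> energy k"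
    using loss unfolding energy_def lyapunov_def by simp
  moreover have "(norm ?q)\<^sup>2 / (2 * \<rho>)
      \<le> (f (x (Suc k)) - m) / 2 + 3 / (2 * \<rho> * \<gamma>\<^sup>2) * (e k)\<^sup>2 + 3 / 2 * c2\<^sup>2 / \<rho> * (step_length k)\<^sup>2"
  proof -
    have "(norm ?q)\<^sup>2 / (2 * \<rho>) \<le> (3 / \<gamma>\<^sup>2 * ((e k)\<^sup>2 + 2 * L * (f (x (Suc k)) - m))
        + 3 * c2\<^sup>2 * (step_length k)\<^sup>2) / (2 * \<rho>)"
      using \<rho> \<gamma> G by (intro divide_right_mono order_trans[OF multiplier_bound] add_right_mono
          mult_left_mono add_left_mono) auto
    also have "\<dots> = (f (x (Suc k)) - m) / 2 + 3 / (2 * \<rho> * \<gamma>\<^sup>2) * (e k)\<^sup>2 + 3 / 2 * c2\<^sup>2 / \<rho> * (step_length k)\<^sup>2"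
      using \<rho> \<gamma> by (simp add: L_def field_simps)
    finally show ?thesis .
  qed
  moreover have "3 / 2 * c2\<^sup>2 / \<rho> * (step_length k)\<^sup>2 \<le> 4 * c2\<^sup>2 / \<rho> * (step_length k)\<^sup>2"
    using \<rho> by (intro mult_right_mono divide_right_mono) auto
  ultimately show ?thesis by argo
qed

lemma energy_telescoped:
  "energy k + \<mu> / 4 * (\<Sum>j<k. (step_length (Suc j))\<^sup>2)
     \<le> energy 0 + 8 / (\<rho> * \<gamma>\<^sup>2) * (\<Sum>j. (e j)\<^sup>2)"
proof -
  have "energy k + \<mu> / 4 * (\<Sum>j<k. (step_length (Suc j))\<^sup>2)
      \<le> energy 0 + 4 / (\<rho> * \<gamma>\<^sup>2) * ((\<Sum>j<k. (e (Suc j))\<^sup>2) + (\<Sum>j<k. (e j)\<^sup>2))"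
  proof (induction k)
    case (Suc k)
    then show ?case using energy_decrease[of k] by (simp add: algebra_simps)
  qed simp
  also have "(\<Sum>j<k. (e (Suc j))\<^sup>2) \<le> (\<Sum>j<Suc k. (e j)\<^sup>2)"
    by (subst sum.lessThan_Suc_shift) simp
  also have "(\<Sum>j<Suc k. (e j)\<^sup>2) \<le> (\<Sum>j. (e j)\<^sup>2)" by (rule sum_le_suminf[OF e]) auto
  also have "(\<Sum>j<k. (e j)\<^sup>2) \<le> (\<Sum>j. (e j)\<^sup>2)" by (rule sum_le_suminf[OF e]) auto
  finally show ?thesis using \<rho> \<gamma> by (simp add: mult_left_mono field_simps)
qed

section \<open>Convergence of the iterates\<close>

lemma bounded_below: obtains m where "\<And>x. m \<le> f x"
proof
  fix x :: "real^'p"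
  have "0 \<le> \<sigma> / 4 * (norm x)\<^sup>2" using \<sigma> by simp
  with quadratic_growth[OF sc \<sigma>, of x] show "f 0 - (norm (grad f 0))\<^sup>2 / \<sigma> \<le> f x" by simp
qed

lemma e_power2_le_suminf: "(e k)\<^sup>2 \<le> (\<Sum>j. (e j)\<^sup>2)"
  using sum_le_suminf[OF e, of "{k}"] by simp

text \<open>
  The telescoped energy inequality bounds the partial sums of the squared steps, since the energy is
  bounded below.
\<close>

lemma step_tendsto_0: "step_length \<longlonglongrightarrow> 0"
proof -
  obtain m where m: "\<And>x. m \<le> f x" using bounded_below by metis
  let ?S = "\<Sum>j. (e j)\<^sup>2"
  let ?C = "energy 0 + 8 / (\<rho> * \<gamma>\<^sup>2) * ?S + 3 / (2 * \<rho> * \<gamma>\<^sup>2) * ?S - m"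
  have bound: "(\<Sum>j<k. (step_length (Suc j))\<^sup>2) \<le> ?C / (\<mu> / 4)" for k
  proof -
    have "3 / (2 * \<rho> * \<gamma>\<^sup>2) * (e k)\<^sup>2 \<le> 3 / (2 * \<rho> * \<gamma>\<^sup>2) * ?S"
      using \<rho> \<gamma> by (intro mult_left_mono e_power2_le_suminf) auto
    then have "\<mu> / 4 * (\<Sum>j<k. (step_length (Suc j))\<^sup>2) \<le> ?C"
      using energy_telescoped[of k] energy_lower_bound[OF m, of k] m[of "x (Suc k)"] by argo
    then show ?thesis using \<mu> by (simp add: pos_le_divide_eq mult.commute)
  qed
  have "summable (\<lambda>j. (step_length (Suc j))\<^sup>2)"
    by (rule summableI_nonneg_bounded[OF _ bound]) simp
  then have "(\<lambda>j. (step_length (Suc j))\<^sup>2) \<longlonglongrightarrow> 0" by (rule summable_LIMSEQ_zero)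
  then have "(\<lambda>j. step_length (Suc j)) \<longlonglongrightarrow> 0" by simp
  then show ?thesis by (rule LIMSEQ_imp_Suc)
qed

text \<open>
  The energy stays bounded above and dominates \<open>f / 2\<close> up to a constant, and \<open>f\<close> grows
  quadratically.
\<close>

lemma bounded_primal: "bounded (range (\<lambda>k. x (Suc k)))"
proof -
  obtain m where m: "\<And>x. m \<le> f x" using bounded_below by metis
  let ?S = "\<Sum>j. (e j)\<^sup>2"
  define C where "C = 2 * (energy 0 + 8 / (\<rho> * \<gamma>\<^sup>2) * ?S + 3 / (2 * \<rho> * \<gamma>\<^sup>2) * ?S) - m"
  define B where "B = (C - f 0 + (norm (grad f 0))\<^sup>2 / \<sigma>) / (\<sigma> / 4)"
  have "(norm (x (Suc k)))\<^sup>2 \<le> B" for k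
  proof -
    have "3 / (2 * \<rho> * \<gamma>\<^sup>2) * (e k)\<^sup>2 \<le> 3 / (2 * \<rho> * \<gamma>\<^sup>2) * ?S"
      using \<rho> \<gamma> by (intro mult_left_mono e_power2_le_suminf) auto
    moreover have "0 \<le> \<mu> / 4 * (\<Sum>j<k. (step_length (Suc j))\<^sup>2)"
      using \<mu> by (simp add: sum_nonneg)
    ultimately have "f (x (Suc k)) \<le> C"
      using energy_telescoped[of k] energy_lower_bound[OF m, of k] unfolding C_def by argo
    then have "\<sigma> / 4 * (norm (x (Suc k)))\<^sup>2 \<le> C - f 0 + (norm (grad f 0))\<^sup>2 / \<sigma>"
      using quadratic_growth[OF sc \<sigma>, of "x (Suc k)"] by argo
    then show ?thesis using \<sigma> by (simp add: B_def pos_le_divide_eq mult.commute)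
  qed
  then have "norm (x (Suc k)) \<le> sqrt B" for k by (simp add: real_le_rsqrt)
  then show ?thesis by (auto simp: bounded_iff)
qed

lemma e_tendsto_0: "e \<longlonglongrightarrow> 0"
  using summable_LIMSEQ_zero[OF e] by simp

text \<open>
  The residual is the multiplier step divided by \<open>\<rho>\<close>, which is bounded by steps and errors.
\<close>

lemma residual_tendsto_0: "(\<lambda>k. A *v x (Suc k) + b - y (Suc k)) \<longlonglongrightarrow> 0"
proof -
  have "(\<lambda>k. 4 * (c1\<^sup>2 * (step_length (Suc k))\<^sup>2 + c2\<^sup>2 * (step_length k)\<^sup>2 + ((e (Suc k))\<^sup>2 + (e k)\<^sup>2) / \<gamma>\<^sup>2))
      \<longlonglongrightarrow> 4 * (c1\<^sup>2 * 0\<^sup>2 + c2\<^sup>2 * 0\<^sup>2 + (0\<^sup>2 + 0\<^sup>2) / \<gamma>\<^sup>2)"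
    using \<gamma> by (intro tendsto_intros LIMSEQ_Suc step_tendsto_0 e_tendsto_0) simp
  then have bound: "(\<lambda>k. 4 * (c1\<^sup>2 * (step_length (Suc k))\<^sup>2 + c2\<^sup>2 * (step_length k)\<^sup>2 + ((e (Suc k))\<^sup>2 + (e k)\<^sup>2) / \<gamma>\<^sup>2))
      \<longlonglongrightarrow> 0" by simp
  have "(\<lambda>k. (norm (q (Suc (Suc k)) - q (Suc k)))\<^sup>2) \<longlonglongrightarrow> 0"
    by (rule real_tendsto_sandwich[OF _ _ tendsto_const bound])
      (simp, rule always_eventually, rule allI, rule multiplier_step_bound)
  then have "(\<lambda>k. q (Suc (Suc k)) - q (Suc k)) \<longlonglongrightarrow> 0"
    by (simp add: tendsto_norm_zero_iff)
  then have "(\<lambda>k. q (Suc k) - q k) \<longlonglongrightarrow> 0" by (rule LIMSEQ_imp_Suc)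
  from tendsto_scaleR[OF tendsto_const[of "1 / \<rho>"] this] show ?thesis
    using \<rho> by (simp add: mult)
qed

text \<open>
  The approximate optimality condition determines the limit of \<open>transpose A *v q (Suc (r k))\<close>, and
  injectivity of \<open>transpose A\<close> transfers convergence to the multipliers themselves. The remaining
  conditions pass to the limit by the vanishing residual and by closedness of the proximal inclusion.
  The statement is for subsequences because it serves twice: for limit points, and, once the \<open>x\<close> part
  converges, for the whole sequence.
\<close>

lemma limit_point_stationary:
  assumes r: "strict_mono r" and lim: "(\<lambda>k. x (Suc (r k))) \<longlonglongrightarrow> w"
  obtains p where "(\<lambda>k. q (Suc (r k))) \<longlonglongrightarrow> p" "(\<lambda>k. y (Suc (r k))) \<longlonglongrightarrow> A *v w + b"
    "P_stationary f lam A b w (A *v w + b) p"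
proof -
  note sub = LIMSEQ_subseq_LIMSEQ[OF _ r, unfolded comp_def]
  let ?R = "\<lambda>k. grad f (x (Suc k)) + \<mu> *\<^sub>R (x (Suc k) - x k) + transpose A *v q (Suc k)"
  have R0: "?R \<longlonglongrightarrow> 0"
    by (rule Lim_null_comparison[OF _ e_tendsto_0]) (intro always_eventually allI dual)
  have "(\<lambda>k. x (Suc k) - x k) \<longlonglongrightarrow> 0"
    using step_tendsto_0 unfolding step_length_def[abs_def] by (rule tendsto_norm_zero_cancel)
  then have x0: "(\<lambda>k. \<mu> *\<^sub>R (x (Suc (r k)) - x (r k))) \<longlonglongrightarrow> \<mu> *\<^sub>R 0"
    by (intro tendsto_scaleR tendsto_const) (rule sub)
  have "continuous_on UNIV (grad f)" using lip by (rule lipschitz_on_continuous_on)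
  then have "isCont (grad f) w" by (simp add: continuous_on_eq_continuous_at)
  then have g: "(\<lambda>k. grad f (x (Suc (r k)))) \<longlonglongrightarrow> grad f w"
    using lim by (rule isCont_tendsto_compose)
  have "(\<lambda>k. ?R (r k) - grad f (x (Suc (r k))) - \<mu> *\<^sub>R (x (Suc (r k)) - x (r k)))
      \<longlonglongrightarrow> 0 - grad f w - \<mu> *\<^sub>R 0"
    by (intro tendsto_diff sub[OF R0] g x0)
  then have "(\<lambda>k. transpose A *v q (Suc (r k))) \<longlonglongrightarrow> - grad f w"
    by (simp del: transpose_matrix_vector)
  then obtain p where p: "(\<lambda>k. q (Suc (r k))) \<longlonglongrightarrow> p" "transpose A *v p = - grad f w"
    by (rule converges_if_bounded_below_image_converges[OF \<gamma> below])
  have "(\<lambda>k. A *v x (Suc (r k))) \<longlonglongrightarrow> A *v w"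
    by (rule isCont_tendsto_compose[OF matrix_vector_mult_linear_continuous_at lim])
  then have "(\<lambda>k. A *v x (Suc (r k)) + b - (A *v x (Suc (r k)) + b - y (Suc (r k))))
      \<longlonglongrightarrow> A *v w + b - 0"
    by (intro tendsto_diff tendsto_add tendsto_const sub[OF residual_tendsto_0])
  then have y: "(\<lambda>k. y (Suc (r k))) \<longlonglongrightarrow> A *v w + b" by simp
  have "(\<lambda>k. infdist (y (Suc k)) (Prox (1 / \<rho>) lam (y (Suc k) + (1 / \<rho>) *\<^sub>R q (Suc k)))) \<longlonglongrightarrow> 0"
    by (rule real_tendsto_sandwich[OF _ _ tendsto_const e_tendsto_0])
      (auto intro!: always_eventually prox infdist_nonneg)
  from sub[OF this] have "A *v w + b \<in> Prox (1 / \<rho>) lam (A *v w + b + (1 / \<rho>) *\<^sub>R p)"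
    using \<rho> lam by (intro Prox_limit[OF _ _ y tendsto_add[OF y tendsto_scaleR[OF tendsto_const p(1)]]]) auto
  then have "P_stationary f lam A b w (A *v w + b) p"
    using \<rho> p(2) unfolding P_stationary_def by (intro exI[of _ "1 / \<rho>"]) auto
  with p(1) y that show thesis by blast
qed

lemma converges_to_stationary:
  obtains w p where "(\<lambda>k. x (Suc k)) \<longlonglongrightarrow> w" "(\<lambda>k. y (Suc k)) \<longlonglongrightarrow> A *v w + b"
    "(\<lambda>k. q (Suc k)) \<longlonglongrightarrow> p" "P_stationary f lam A b w (A *v w + b) p"
proof -
  have "\<exists>w\<in>{w. \<exists>u p. P_stationary f lam A b w u p}. (\<lambda>k. x (Suc k)) \<longlonglongrightarrow> w"
  proof (rule converges_if_finitely_many_limit_points[OF bounded_primal])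
    show "(\<lambda>k. dist (x (Suc (Suc k))) (x (Suc k))) \<longlonglongrightarrow> 0"
      using LIMSEQ_Suc[OF step_tendsto_0] by (simp add: step_length_def dist_norm)
    show "finite {w. \<exists>u p. P_stationary f lam A b w u p}"
      by (rule finite_stationary_points[OF sc \<sigma>])
    fix r :: "nat \<Rightarrow> nat" and w
    assume r: "strict_mono r" and "((\<lambda>k. x (Suc k)) \<circ> r) \<longlonglongrightarrow> w"
    then show "w \<in> {w. \<exists>u p. P_stationary f lam A b w u p}"
      by (auto simp: comp_def elim!: limit_point_stationary[OF r])
  qed
  then obtain w where w: "(\<lambda>k. x (Suc k)) \<longlonglongrightarrow> w" by blast
  show thesis
    by (rule limit_point_stationary[of "\<lambda>k. k" w]) (use w that in \<open>auto simp: strict_mono_def\<close>)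
qed

end

section \<open>Convergence of the algorithm\<close>

lemma grad_h_sub_w:
  fixes A :: "real^'p^'n"
  assumes "GDERIV f w' :> D"
  shows "grad (\<lambda>w. h_sub f A b \<rho> \<mu> z v w u) w'
    = D + \<mu> *\<^sub>R (w' - v) + transpose A *v (z + \<rho> *\<^sub>R (A *v w' + b - u))"
proof (rule grad_eqI, unfold gderiv_def)
  note [derivative_intros] = bounded_linear.has_derivative[OF matrix_vector_mul_bounded_linear[of A]]
  have f: "(f has_derivative (\<lambda>h. h \<bullet> D)) (at w')" using assms by (simp add: gderiv_def)
  let ?r = "A *v w' + b - u"
  have "((\<lambda>w. h_sub f A b \<rho> \<mu> z v w u) has_derivative
      (\<lambda>h. h \<bullet> D + \<mu> / 2 * ((w' - v) \<bullet> h + h \<bullet> (w' - v)) + z \<bullet> (A *v h)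
        + \<rho> / 2 * (?r \<bullet> (A *v h) + (A *v h) \<bullet> ?r))) (at w')"
    unfolding h_sub_def power2_norm_eq_inner
    by (auto intro!: derivative_eq_intros f)
  moreover have "h \<bullet> D + \<mu> / 2 * ((w' - v) \<bullet> h + h \<bullet> (w' - v)) + z \<bullet> (A *v h)
        + \<rho> / 2 * (?r \<bullet> (A *v h) + (A *v h) \<bullet> ?r)
      = h \<bullet> (D + \<mu> *\<^sub>R (w' - v) + transpose A *v (z + \<rho> *\<^sub>R ?r))" for h
  proof -
    have "h \<bullet> (transpose A *v (z + \<rho> *\<^sub>R ?r)) = z \<bullet> (A *v h) + \<rho> * (?r \<bullet> (A *v h))"
      unfolding inner_commute[of h] inner_transpose by (simp add: inner_add_left)
    then show ?thesis
      by (simp add: inner_add_right inner_commute[of _ h] inner_commute[of "A *v h"]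
          del: transpose_matrix_vector)
  qed
  ultimately show "((\<lambda>w. h_sub f A b \<rho> \<mu> z v w u) has_derivative
      (\<lambda>h. h \<bullet> (D + \<mu> *\<^sub>R (w' - v) + transpose A *v (z + \<rho> *\<^sub>R ?r)))) (at w')"
    by (simp only:)
qed

lemma grad_h_sub_u:
  fixes A :: "real^'p^'n"
  shows "grad (\<lambda>u. h_sub f A b \<rho> \<mu> z v w u) u' = - (z + \<rho> *\<^sub>R (A *v w + b - u'))"
proof (rule grad_eqI, unfold gderiv_def)
  let ?r = "A *v w + b - u'"
  have "((\<lambda>u. h_sub f A b \<rho> \<mu> z v w u) has_derivative
      (\<lambda>h. z \<bullet> (- h) + \<rho> / 2 * (?r \<bullet> (- h) + (- h) \<bullet> ?r))) (at u')"
    unfolding h_sub_def power2_norm_eq_inner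
    by (auto intro!: derivative_eq_intros)
  moreover have "z \<bullet> (- h) + \<rho> / 2 * (?r \<bullet> (- h) + (- h) \<bullet> ?r) = h \<bullet> (- (z + \<rho> *\<^sub>R ?r))" for h
    by (simp add: inner_add_right inner_diff_right inner_commute[of _ h] algebra_simps)
  ultimately show "((\<lambda>u. h_sub f A b \<rho> \<mu> z v w u) has_derivative
      (\<lambda>h. h \<bullet> (- (z + \<rho> *\<^sub>R ?r)))) (at u')"
    by (simp only:)
qed

text \<open>
  The square root in the hypothesis becomes the ratio \<open>c\<close> of the squares, so the ratio test
  applies to the squares directly.
\<close>

lemma power2_summable_if_ratio_bounded:
  fixes e :: "nat \<Rightarrow> real"
  assumes "\<And>k. e k > 0" and "\<And>k. e (Suc k) / e k \<le> sqrt c" and "c < 1"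
  shows "summable (\<lambda>k. (e k)\<^sup>2)"
proof (rule summable_ratio_test[OF \<open>c < 1\<close>])
  fix k :: nat
  have "0 < e (Suc k) / e k" using assms(1) by simp
  then have "0 < sqrt c" using assms(2) by (rule less_le_trans)
  \<comment> \<open>needed for \<open>(sqrt c)\<^sup>2 = c\<close>\<close>
  then have "0 < c" by (simp only: real_sqrt_gt_0_iff)
  then have "(e (Suc k) / e k)\<^sup>2 \<le> c"
    using assms(2)[of k] \<open>0 < e (Suc k) / e k\<close> power_mono[of "e (Suc k) / e k" "sqrt c" 2] by simp
  then show "norm ((e (Suc k))\<^sup>2) \<le> c * norm ((e k)\<^sup>2)"
    using assms(1)[of k] by (simp add: power_divide pos_divide_le_eq)
qed

theorem theorem7:
  fixes f g :: "real^'p \<Rightarrow> real"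
    and A :: "real^'p^'n" and b :: "real^'n"
    and lam \<rho> \<mu> \<alpha> \<beta> \<eta> \<gamma> c1 c2 lf lg t :: real
    and Q :: "nat \<Rightarrow> nat \<Rightarrow> real^'p^'p"
    and \<epsilon> :: "nat \<Rightarrow> real"
    and w v :: "nat \<Rightarrow> real^'p" and u z :: "nat \<Rightarrow> real^'n"
  assumes "lam > 0" and "\<rho> > 0" and "\<mu> > 0"
    and "C1 f" and "smooth_with lf f" and "strongly_convex f"
    and "rank A = CARD('n)"
    and "\<gamma> = sqrt (theta_min (A ** transpose A))" and "\<gamma> > 0"
    and "c1 = (\<mu> + lf) / \<gamma>" and "c2 = \<mu> / \<gamma>"
    and "\<rho> > max (16 * (c1\<^sup>2 + c2\<^sup>2) / \<mu>) (6 * lf / \<gamma>\<^sup>2)"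
    and "\<alpha> = 1 / \<rho>"
    and "\<beta> = 8 * c2\<^sup>2 / \<rho>"
    and "\<eta> > 4 / (\<rho> * \<gamma>\<^sup>2)"
    and "\<And>k. \<epsilon> k > 0"
    and "\<And>k. \<epsilon> (Suc k) / \<epsilon> k \<le> sqrt ((\<rho> * \<gamma>\<^sup>2 * \<eta> - 4) / (\<rho> * \<gamma>\<^sup>2 * \<eta> + 4))"
    and "t > 0" and "\<And>k j. sym_psd (Q k j)" and "smooth_with lg g"
    and "IALM f lam A b \<rho> \<mu> \<alpha> t Q g \<epsilon> w u z v"
  shows "\<exists>ws us zs.
           (\<lambda>k. (w k, u k, z k, v k)) \<longlonglongrightarrow> (ws, us, zs, ws)
         \<and> P_stationary f lam A b ws us zs
         \<and> local_minimizer (objective f lam) (feasible_set A b) (ws, us)"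
proof -
  have gr: "GDERIV f x :> grad f x" for x
    using \<open>smooth_with lf f\<close> by (intro GDERIV_grad) (simp add: smooth_with_def)
  obtain \<sigma> where "\<sigma> > 0"
    and sc: "\<And>x y. f x + grad f x \<bullet> (y - x) + \<sigma> / 2 * (norm (y - x))\<^sup>2 \<le> f y"
    using strongly_convex_first_order[OF gr \<open>strongly_convex f\<close>] by blast
  note step = \<open>IALM f lam A b \<rho> \<mu> \<alpha> t Q g \<epsilon> w u z v\<close>[unfolded IALM_def Let_def, rule_format]
  have z: "z (Suc k) = z k + \<rho> *\<^sub>R (A *v w (Suc k) + b - u (Suc k))"
    and v: "v (Suc k) = w (Suc k)" for k using step by blast+
  have \<epsilon>: "summable (\<lambda>k. (\<epsilon> k)\<^sup>2)"
  proof (rule power2_summable_if_ratio_bounded)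
    have "4 < \<rho> * \<gamma>\<^sup>2 * \<eta>"
      using \<open>\<eta> > _\<close> \<open>\<rho> > 0\<close> \<open>\<gamma> > 0\<close> by (simp add: divide_less_eq mult.commute)
    then show "(\<rho> * \<gamma>\<^sup>2 * \<eta> - 4) / (\<rho> * \<gamma>\<^sup>2 * \<eta> + 4) < 1" by simp
  qed (rule assms)+
  \<comment> \<open>two shifts in all: one for the arbitrary initial centre, one inside the locale\<close>
  have tail: "ialm_tail f A b lam \<rho> \<mu> \<gamma> lf \<sigma> (\<lambda>k. w (Suc k)) (\<lambda>k. u (Suc k)) (\<lambda>k. z (Suc k))
      (\<lambda>k. \<epsilon> (Suc k))"
  proof
    show "lf-lipschitz_on UNIV (grad f)" using \<open>smooth_with lf f\<close> by (simp add: smooth_with_def)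
    show "\<gamma> * norm p \<le> norm (transpose A *v p)" for p
      by (rule transpose_bounded_below) fact+
    show "16 * (((\<mu> + lf) / \<gamma>)\<^sup>2 + (\<mu> / \<gamma>)\<^sup>2) \<le> \<rho> * \<mu>"
      using assms(12) \<open>\<mu> > 0\<close> unfolding \<open>c1 = _\<close> \<open>c2 = _\<close> by (simp add: pos_divide_less_eq)
    show "6 * lf \<le> \<rho> * \<gamma>\<^sup>2"
      using assms(12) \<open>\<gamma> > 0\<close> by (simp add: pos_divide_less_eq)
    show "summable (\<lambda>k. (\<epsilon> (Suc k))\<^sup>2)" using \<epsilon> by (subst summable_Suc_iff)
    fix k
    have b: "stop_b \<alpha> lam (h_sub f A b \<rho> \<mu> (z (Suc k)) (v (Suc k))) (\<epsilon> (Suc k))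
        (w (Suc (Suc k))) (u (Suc (Suc k)))" using step by blast
    show "norm (grad f (w (Suc (Suc k))) + \<mu> *\<^sub>R (w (Suc (Suc k)) - w (Suc k))
        + transpose A *v z (Suc (Suc k))) \<le> \<epsilon> (Suc k)"
      using b by (simp add: stop_b_def grad_h_sub_w[OF gr] v z[of "Suc k"]
          del: transpose_matrix_vector)
    show "infdist (u (Suc (Suc k))) (Prox (1 / \<rho>) lam (u (Suc (Suc k))
        + (1 / \<rho>) *\<^sub>R z (Suc (Suc k)))) \<le> \<epsilon> (Suc k)"
    proof -
      have "grad (\<lambda>y. h_sub f A b \<rho> \<mu> (z (Suc k)) (v (Suc k)) (w (Suc (Suc k))) y) (u (Suc (Suc k)))
          = - z (Suc (Suc k))"
        by (simp only: grad_h_sub_u z[of "Suc k"])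
      with b show ?thesis by (simp add: stop_b_def \<open>\<alpha> = 1 / \<rho>\<close>)
    qed
    show "lyapunov f lam A b \<rho> \<mu> (w (Suc (Suc k))) (u (Suc (Suc k))) (z (Suc k)) (w (Suc k))
        \<le> lyapunov f lam A b \<rho> \<mu> (w (Suc k)) (u (Suc k)) (z (Suc k)) (w (Suc k))"
      using step[of "Suc k"] by (simp add: stop_a_def v)
  qed (rule \<open>lam > 0\<close> \<open>\<rho> > 0\<close> \<open>\<mu> > 0\<close> \<open>\<gamma> > 0\<close> \<open>\<sigma> > 0\<close> gr sc z)+
  obtain ws zs where lim: "(\<lambda>k. w (Suc (Suc k))) \<longlonglongrightarrow> ws" "(\<lambda>k. u (Suc (Suc k))) \<longlonglongrightarrow> A *v ws + b"
    "(\<lambda>k. z (Suc (Suc k))) \<longlonglongrightarrow> zs"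
    and st: "P_stationary f lam A b ws (A *v ws + b) zs"
    by (rule ialm_tail.converges_to_stationary[OF tail])
  have "(\<lambda>k. v (Suc (Suc k))) \<longlonglongrightarrow> ws" using lim(1) by (simp add: v)
  with lim have "(\<lambda>k. (w (Suc (Suc k)), u (Suc (Suc k)), z (Suc (Suc k)), v (Suc (Suc k))))
      \<longlonglongrightarrow> (ws, A *v ws + b, zs, ws)" by (intro tendsto_Pair)
  then have "(\<lambda>k. (w k, u k, z k, v k)) \<longlonglongrightarrow> (ws, A *v ws + b, zs, ws)"
    by (rule LIMSEQ_imp_Suc[OF LIMSEQ_imp_Suc])
  moreover have "local_minimizer (objective f lam) (feasible_set A b) (ws, A *v ws + b)"
  proof (rule stationary_imp_local_minimizer[OF _ _ \<open>lam > 0\<close> st])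
    show "f x + grad f x \<bullet> (y - x) \<le> f y" for x y
    proof -
      have "0 \<le> \<sigma> / 2 * (norm (y - x))\<^sup>2" using \<open>\<sigma> > 0\<close> by simp
      with sc[of x y] show ?thesis by simp
    qed
    show "isCont f ws"
      using gr[of ws] unfolding gderiv_def by (rule has_derivative_continuous)
  qed
  ultimately show ?thesis using st by blast
qed

end
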